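(* $\mathscr{F}_{\mathrm{opt}} \cap \mathscr{F}_{\mathrm{AIFV}} \neq \emptyset$. That is, there exists an AIFV code-tuple which attains the minimum average codeword length $L(F)$ over all regular, extendable, $2$-bit delay decodable code-tuples $F$ (with any finite number of code tables).
   Context: Throughout, $\mathcal{S}$ is a finite source alphabet with $|\mathcal{S}|\ge 2$ and $\mathcal{C}=\{0,1\}$. For a set $\mathcal{A}$, $\mathcal{A}^k$, $\mathcal{A}^{\ast}$, $\mathcal{A}^{+}$ denote the sets of sequences over $\mathcal{A}$ of length $k$, of finite length, and of finite positive length; $\lambda$ is the empty sequence and $|\pmb{x}|$ the length. $\pmb{x}\preceq\pmb{y}$ means $\pmb{y}=\pmb{x}\pmb{z}$ for some (possibly empty) $\pmb{z}$, and $\pmb{x}\prec\pmb{y}$ means $\pmb{x}\preceq\pmb{y}$ and $\pmb{x}\neq\pmb{y}$. For nonempty $\pmb{x}=x_1\cdots x_n$, $\mathrm{suff}(\pmb{x})=x_2\cdots x_n$. A code-tuple $F$ with $m\ge 1$ code tables is a tuple $(f_0,\dots,f_{m-1},\tau_0,\dots,\tau_{m-1})$ of maps $f_i:\mathcal{S}\to\mathcal{C}^{\ast}$ and $\tau_i:\mathcal{S}\to\{0,\dots,m-1\}$; write $|F|=m$, $[F]=\{0,\dots,m-1\}$. For $i\in[F]$ define $f_i^{\ast}:\mathcal{S}^{\ast}\to\mathcal{C}^{\ast}$, $\tau_i^{\ast}:\mathcal{S}^{\ast}\to[F]$ by $f_i^{\ast}(\lambda)=\lambda$, $\tau_i^{\ast}(\lambda)=i$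 and, for $\pmb{x}=x_1\cdots x_n\neq\lambda$, $f_i^{\ast}(\pmb{x})=f_i(x_1)f^{\ast}_{\tau_i(x_1)}(\mathrm{suff}(\pmb{x}))$, $\tau_i^{\ast}(\pmb{x})=\tau^{\ast}_{\tau_i(x_1)}(\mathrm{suff}(\pmb{x}))$. For an integer $k\ge 0$ and $\pmb{b}\in\mathcal{C}^{\ast}$, $\mathcal{P}^k_{F,i}(\pmb{b})$ is the set of $\pmb{c}\in\mathcal{C}^k$ such that some $\pmb{x}=x_1\cdots x_n\in\mathcal{S}^{+}$ satisfies $f_i^{\ast}(\pmb{x})\succeq\pmb{b}\pmb{c}$ and $f_i(x_1)\succeq\pmb{b}$; $\bar{\mathcal{P}}^k_{F,i}(\pmb{b})$ is defined the same way with $f_i(x_1)\succ\pmb{b}$. Write $\mathcal{P}^k_{F,i}=\mathcal{P}^k_{F,i}(\lambda)$, $\bar{\mathcal{P}}^k_{F,i}=\bar{\mathcal{P}}^k_{F,i}(\lambda)$. $F$ is $k$-bit delay decodable if (i) $\mathcal{P}^k_{F,\tau_i(s)}\cap\bar{\mathcal{P}}^k_{F,i}(f_i(s))=\emptyset$ for all $i\in[F]$, $s\in\mathcal{S}$, and (ii) $\mathcal{P}^k_{F,\tau_i(s)}\cap\mathcal{P}^k_{F,\tau_i(s')}=\emptyset$ whenever $i\in[F]$, $s\neq s'$ and $f_i(s)=f_i(s')$; $\mathscr{F}_{2\text{-}\mathrm{dec}}$ is the set of $2$-bit delay decodable code-tuples. $F$ is extendable if $\mathcal{P}^1_{F,i}\neq\emptyset$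 for all $i\in[F]$; $\mathscr{F}_{\mathrm{ext}}$ is the set of extendable code-tuples. Fix $\mu:\mathcal{S}\to(0,1]$ with $\sum_{s}\mu(s)=1$. For a code-tuple $F$ let $Q(F)$ be the $|F|\times|F|$ matrix with entries $Q_{i,j}(F)=\sum_{s:\tau_i(s)=j}\mu(s)$. $F$ is regular if the system $\pmb{\pi}Q(F)=\pmb{\pi}$, $\sum_{i\in[F]}\pi_i=1$ has a unique solution $\pmb{\pi}(F)=(\pi_0(F),\dots,\pi_{|F|-1}(F))$; $\mathscr{F}_{\mathrm{reg}}$ is the set of regular code-tuples. Let $L_i(F)=\sum_{s}|f_i(s)|\mu(s)$ and, for regular $F$, $L(F)=\sum_{i\in[F]}\pi_i(F)L_i(F)$. Let $\mathscr{F}_0=\mathscr{F}_{\mathrm{reg}}\cap\mathscr{F}_{\mathrm{ext}}\cap\mathscr{F}_{2\text{-}\mathrm{dec}}$ and $\mathscr{F}_{\mathrm{opt}}=\{F\in\mathscr{F}_0: L(F)\le L(F')\text{ for all }F'\in\mathscr{F}_0\}$. $\mathscr{F}_{\mathrm{AIFV}}$ is the set of code-tuples $F$ with $|F|=2$ satisfying: (i) $f_0,f_1$ are injective; (ii) for all $i\in\{0,1\}$, $s\in\mathcal{S}$: $1\notin\bar{\mathcal{P}}^1_{F,i}(f_i(s))$ and $1\notin\bar{\mathcal{P}}^1_{F,i}(f_i(s)0)$; (iii) $f_i(s')\neq f_i(s)0$ for all $i\in\{0,1\}$, $s,s'\in\mathcal{S}$; (iv) for all $i,s$: $\tau_i(s)=0$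 if $\bar{\mathcal{P}}^0_{F,i}(f_i(s))=\emptyset$ and $\tau_i(s)=1$ otherwise; (v) $f_1(s)\neq\lambda$ and $f_1(s)\neq 0$ for all $s$; (vi) $0\notin\bar{\mathcal{P}}^1_{F,1}(0)$; (vii) for all $i\in\{0,1\}$ and $\pmb{b}\in\mathcal{C}^{\ast}$ with $|\bar{\mathcal{P}}^1_{F,i}(\pmb{b})|=1$, either $f_i(s)\pmb{c}=\pmb{b}$ for some $s\in\mathcal{S}$ and $\pmb{c}\in\mathcal{C}^0\cup\mathcal{C}^1$, or $(i,\pmb{b})=(1,0)$. *)

theory Defs
  imports Complex_Main "HOL-Library.Sublist"
begin

text \<open>Code alphabet C = {0,1} is represented by bool, with False = 0 and True = 1;
  code sequences are bool lists, source sequences are lists over the source type 's.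
  A code-tuple with m code tables: tables indexed by 0..m-1; values of fc/tc at
  indices \<ge> m are irrelevant.\<close>

record 's code_tuple =
  ntab :: nat
  fc :: "nat \<Rightarrow> 's \<Rightarrow> bool list"
  tc :: "nat \<Rightarrow> 's \<Rightarrow> nat"

definition wf_ct :: "'s code_tuple \<Rightarrow> bool" where
  "wf_ct F \<longleftrightarrow> ntab F \<ge> 1 \<and> (\<forall>i < ntab F. \<forall>s. tc F i s < ntab F)"

fun fstar :: "'s code_tuple \<Rightarrow> nat \<Rightarrow> 's list \<Rightarrow> bool list" where
  "fstar F i [] = []"
| "fstar F i (x # xs) = fc F i x @ fstar F (tc F i x) xs"

fun taustar :: "'s code_tuple \<Rightarrow> nat \<Rightarrow> 's list \<Rightarrow> nat" where
  "taustar F i [] = i"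
| "taustar F i (x # xs) = taustar F (tc F i x) xs"

definition Pset :: "'s code_tuple \<Rightarrow> nat \<Rightarrow> nat \<Rightarrow> bool list \<Rightarrow> bool list set" where
  "Pset F k i b = {c. length c = k \<and> (\<exists>x::'s list. x \<noteq> [] \<and>
      prefix (b @ c) (fstar F i x) \<and> prefix b (fc F i (hd x)))}"

definition Pbar :: "'s code_tuple \<Rightarrow> nat \<Rightarrow> nat \<Rightarrow> bool list \<Rightarrow> bool list set" where
  "Pbar F k i b = {c. length c = k \<and> (\<exists>x::'s list. x \<noteq> [] \<and>
      prefix (b @ c) (fstar F i x) \<and> strict_prefix b (fc F i (hd x)))}"

definition k_bit_delay_decodable :: "nat \<Rightarrow> 's code_tuple \<Rightarrow> bool" where
  "k_bit_delay_decodable k F \<longleftrightarrow>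
     (\<forall>i < ntab F. \<forall>s. Pset F k (tc F i s) [] \<inter> Pbar F k i (fc F i s) = {}) \<and>
     (\<forall>i < ntab F. \<forall>s s'. s \<noteq> s' \<and> fc F i s = fc F i s' \<longrightarrow>
        Pset F k (tc F i s) [] \<inter> Pset F k (tc F i s') [] = {})"

definition F_2dec :: "'s code_tuple set" where
  "F_2dec = {F. wf_ct F \<and> k_bit_delay_decodable 2 F}"

definition F_ext :: "'s code_tuple set" where
  "F_ext = {F. wf_ct F \<and> (\<forall>i < ntab F. Pset F 1 i [] \<noteq> {})}"

definition Qmat :: "('s \<Rightarrow> real) \<Rightarrow> 's code_tuple \<Rightarrow> nat \<Rightarrow> nat \<Rightarrow> real" where
  "Qmat \<mu> F i j = (\<Sum>s \<in> {s. tc F i s = j}. \<mu> s)"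

text \<open>Stationary distributions: vectors in R^m represented as functions nat \<Rightarrow> real vanishing
  outside {0..<m}.\<close>
definition stationary :: "('s \<Rightarrow> real) \<Rightarrow> 's code_tuple \<Rightarrow> (nat \<Rightarrow> real) \<Rightarrow> bool" where
  "stationary \<mu> F \<pi> \<longleftrightarrow> (\<forall>j. j \<ge> ntab F \<longrightarrow> \<pi> j = 0) \<and>
     (\<forall>j < ntab F. (\<Sum>i < ntab F. \<pi> i * Qmat \<mu> F i j) = \<pi> j) \<and>
     (\<Sum>i < ntab F. \<pi> i) = 1"

definition F_reg :: "('s \<Rightarrow> real) \<Rightarrow> 's code_tuple set" where
  "F_reg \<mu> = {F. wf_ct F \<and> (\<exists>!\<pi>. stationary \<mu> F \<pi>)}"

definition pi_ct :: "('s \<Rightarrow> real) \<Rightarrow> 's code_tuple \<Rightarrow> nat \<Rightarrow> real" where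
  "pi_ct \<mu> F = (THE \<pi>. stationary \<mu> F \<pi>)"

definition Li :: "('s \<Rightarrow> real) \<Rightarrow> 's code_tuple \<Rightarrow> nat \<Rightarrow> real" where
  "Li \<mu> F i = (\<Sum>s \<in> UNIV. real (length (fc F i s)) * \<mu> s)"

definition Lavg :: "('s \<Rightarrow> real) \<Rightarrow> 's code_tuple \<Rightarrow> real" where
  "Lavg \<mu> F = (\<Sum>i < ntab F. pi_ct \<mu> F i * Li \<mu> F i)"

definition F_0 :: "('s \<Rightarrow> real) \<Rightarrow> 's code_tuple set" where
  "F_0 \<mu> = F_reg \<mu> \<inter> F_ext \<inter> F_2dec"

definition F_opt :: "('s \<Rightarrow> real) \<Rightarrow> 's code_tuple set" where
  "F_opt \<mu> = {F \<in> F_0 \<mu>. \<forall>F' \<in> F_0 \<mu>. Lavg \<mu> F \<le> Lavg \<mu> F'}"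

definition F_AIFV :: "'s code_tuple set" where
  "F_AIFV = {F. ntab F = 2 \<and>
     (\<forall>i < 2. inj (fc F i)) \<and>
     (\<forall>i < 2. \<forall>s. [True] \<notin> Pbar F 1 i (fc F i s) \<and> [True] \<notin> Pbar F 1 i (fc F i s @ [False])) \<and>
     (\<forall>i < 2. \<forall>s s'. fc F i s' \<noteq> fc F i s @ [False]) \<and>
     (\<forall>i < 2. \<forall>s. tc F i s = (if Pbar F 0 i (fc F i s) = {} then 0 else 1)) \<and>
     (\<forall>s. fc F 1 s \<noteq> [] \<and> fc F 1 s \<noteq> [False]) \<and>
     [False] \<notin> Pbar F 1 1 [False] \<and>
     (\<forall>i < 2. \<forall>b. card (Pbar F 1 i b) = 1 \<longrightarrow>
        (\<exists>s c. length c \<le> 1 \<and> fc F i s @ c = b) \<or> (i = 1 \<and> b = [False]))}"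

end

theory Submission
  imports Defs
begin

text \<open>
  Two-bit delay decodability only depends on the sets of the first two bits that the tables can emit:
  it says that, within each table, the regions of the code tree occupied by the codewords together with
  the first two bits of the respective next tables are pairwise disjoint. Give a table whose set of first
  two bits has 4, 3, 2 or 1 elements the potential \<open>0\<close>, \<open>h\<close>, \<open>1\<close> or \<open>2\<close>. Moving subtrees turns any such
  family of regions into an AIFV table of no larger average length plus expected next potential; a set of
  3 elements leads to an AIFV table of type 1, and sets of 2 or 1 elements force one or two wasted bits.
  Let \<open>v\<close> be the minimal cost of an AIFV table of type 0. By the intermediate value theorem \<open>h\<close> can be
  chosen such that the minimal cost for type 1 is \<open>v + h\<close>. Averaging over the stationary distribution
  cancels the potentials, so every code-tuple has average length at least \<open>v\<close>, and the pair of optimal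
  AIFV tables attains \<open>v\<close>.
\<close>

text \<open>The number \<open>v\<close> and the potential solve the optimality equations of an
  average-cost decision problem: in the current state one pays the average length of a table plus
  the expected potential of the next state. This is why arbitrarily many tables do no harm: a table
  matters to the others only through its set of first two bits, and such a set has one of five
  shapes. The values 2 and 1 count predictable bits. For two pairs that begin differently the first
  bit predicts the second, so they are worth as much as two pairs that begin alike. The value of
  three pairs cannot be read off, because it trades a shorter codeword now against a restricted
  table later. The obstacle is that two pairs beginning differently are not a subtree: they leave
  one gap below each child, and the surgery has to bring separated gaps together.\<close>

section \<open>Trees for the two tables\<close>

text \<open>\<open>Part s t\<close> puts the codeword of \<open>s\<close> at the current node and the tree \<open>t\<close> two levels below it,
  along 00; \<open>s\<close> then switches to table 1, which never emits 00 first.\<close>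
datatype (syms: 's) aifv_tree =
    Leaf 's
  | Part 's "'s aifv_tree"
  | Node "'s aifv_tree" "'s aifv_tree"

primrec good :: "'s aifv_tree \<Rightarrow> bool" where
  "good (Leaf s) = True"
| "good (Part s t) = (s \<notin> syms t \<and> good t)"
| "good (Node t u) = (syms t \<inter> syms u = {} \<and> good t \<and> good u)"

primrec partials :: "'s aifv_tree \<Rightarrow> 's set" where
  "partials (Leaf s) = {}"
| "partials (Part s t) = insert s (partials t)"
| "partials (Node t u) = partials t \<union> partials u"

primrec enc :: "'s aifv_tree \<Rightarrow> 's \<Rightarrow> bool list" where
  "enc (Leaf a) s = []"
| "enc (Part a t) s = (if s = a then [] else False # False # enc t s)"
| "enc (Node t u) s = (if s \<in> syms t then False # enc t s else True # enc u s)"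

text \<open>Table 1 is a pair of trees hung below the nodes 01 and 1.\<close>
definition enc1 :: "'s aifv_tree \<times> 's aifv_tree \<Rightarrow> 's \<Rightarrow> bool list" where
  "enc1 p s = (if s \<in> syms (fst p) then False # True # enc (fst p) s else True # enc (snd p) s)"

text \<open>Average codeword length plus \<open>h\<close> for every switch to table 1.\<close>
primrec tree_cost :: "('s \<Rightarrow> real) \<Rightarrow> real \<Rightarrow> 's aifv_tree \<Rightarrow> real" where
  "tree_cost \<mu> h (Leaf s) = 0"
| "tree_cost \<mu> h (Part s t) = h * \<mu> s + 2 * sum \<mu> (syms t) + tree_cost \<mu> h t"
| "tree_cost \<mu> h (Node t u) =
     sum \<mu> (syms t) + sum \<mu> (syms u) + tree_cost \<mu> h t + tree_cost \<mu> h u"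

definition pair_cost :: "('s \<Rightarrow> real) \<Rightarrow> real \<Rightarrow> 's aifv_tree \<times> 's aifv_tree \<Rightarrow> real" where
  "pair_cost \<mu> h p = 2 * sum \<mu> (syms (fst p)) + sum \<mu> (syms (snd p))
     + tree_cost \<mu> h (fst p) + tree_cost \<mu> h (snd p)"

definition trees_on :: "'s set \<Rightarrow> 's aifv_tree set" where
  "trees_on X = {t. good t \<and> syms t = X}"

definition pairs_on :: "'s set \<Rightarrow> ('s aifv_tree \<times> 's aifv_tree) set" where
  "pairs_on X = {(t, u). good (Node t u) \<and> syms t \<union> syms u = X}"

section \<open>Finiteness of the sets of trees, and the cost of a tree\<close>

lemma finite_syms [simp]: "finite (syms t)"
  by (induction t) auto

lemma syms_nonempty [simp]: "syms t \<noteq> {}"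
  by (induction t) auto

lemma partials_psubset: "good t \<Longrightarrow> partials t \<subset> syms t"
proof (induction t)
  case (Node t u)
  have "partials t \<union> partials u \<noteq> syms t \<union> syms u"
    using Node by auto
  then show ?case using Node by auto
next
  case (Part s t)
  then have "partials t \<subset> syms t" "s \<notin> syms t" by auto
  then show ?case by auto
qed auto

lemma finite_partials [simp]: "finite (partials t)"
  by (induction t) auto

text \<open>Minima over trees exist because no symbol repeats in a good tree: passing to a subtree
  strictly decreases the number of symbols, so this number serves as the induction bound.\<close>

lemma finite_trees:
  assumes "finite X"
  shows "finite {t. good t \<and> syms t \<subseteq> X}"
proof -
  have *: "finite {t. good t \<and> syms t \<subseteq> X \<and> card (syms t) \<le> n}" for n
  proof (induction n)
    case 0
    have "{t. good t \<and> syms t \<subseteq> X \<and> card (syms t) \<le> 0} = {}"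
      by (auto simp: card_eq_0_iff)
    then show ?case by simp
  next
    case (Suc n)
    let ?T = "\<lambda>n. {t. good t \<and> syms t \<subseteq> X \<and> card (syms t) \<le> n}"
    have "t \<in> Leaf ` X \<union> (\<lambda>(s, t). Part s t) ` (X \<times> ?T n) \<union>
        (\<lambda>(t, u). Node t u) ` (?T n \<times> ?T n)" if t: "t \<in> ?T (Suc n)" for t
    proof (cases t)
      case (Node a b)
      have "card (syms a \<union> syms b) = card (syms a) + card (syms b)"
        using t Node by (intro card_Un_disjoint) auto
      moreover have "card (syms a) > 0" "card (syms b) > 0"
        by (simp_all add: card_gt_0_iff)
      ultimately show ?thesis using t Node by auto
    qed (use t in auto)
    then have "?T (Suc n) \<subseteq> Leaf ` X \<union> (\<lambda>(s, t). Part s t) ` (X \<times> ?T n) \<union>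
        (\<lambda>(t, u). Node t u) ` (?T n \<times> ?T n)" by blast
    then show ?case
      by (rule finite_subset) (use Suc assms in auto)
  qed
  have "{t. good t \<and> syms t \<subseteq> X}
      \<subseteq> {t. good t \<and> syms t \<subseteq> X \<and> card (syms t) \<le> card X}"
    by (auto intro: card_mono assms)
  then show ?thesis using * by (rule finite_subset)
qed

lemma finite_trees_on: "finite X \<Longrightarrow> finite (trees_on X)"
  unfolding trees_on_def by (rule finite_subset[OF _ finite_trees]) auto

lemma finite_pairs_on:
  assumes "finite X"
  shows "finite (pairs_on X)"
proof (rule finite_subset)
  show "pairs_on X \<subseteq> {t. good t \<and> syms t \<subseteq> X} \<times> {t. good t \<and> syms t \<subseteq> X}"
    by (auto simp: pairs_on_def)
qed (use finite_trees[OF assms] in simp)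

lemma sum_length_Cons:
  "(\<Sum>s\<in>X. \<mu> s * real (length (c # e s))) = sum \<mu> X + (\<Sum>s\<in>X. \<mu> s * real (length (e s)))"
  by (simp add: algebra_simps sum.distrib)

text \<open>Double counting: the recursion charges each edge the mass of the symbols below it, so a
  symbol is charged once per bit of its codeword. Goodness makes the unions disjoint, so masses
  add.\<close>

lemma tree_cost_eq:
  assumes "good t"
  shows "tree_cost \<mu> h t = (\<Sum>s\<in>syms t. \<mu> s * real (length (enc t s))) + h * sum \<mu> (partials t)"
  using assms
proof (induction t)
  case (Part a t)
  have "(\<Sum>s\<in>syms t. \<mu> s * real (length (enc (Part a t) s)))
      = (\<Sum>s\<in>syms t. \<mu> s * real (length (False # False # enc t s)))"
    using Part by (intro sum.cong) auto
  also have "\<dots> = 2 * sum \<mu> (syms t) + (\<Sum>s\<in>syms t. \<mu> s * real (length (enc t s)))"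
    by (simp only: sum_length_Cons finite_syms)
  moreover have "a \<notin> partials t"
    using Part partials_psubset[of t] by auto
  ultimately show ?case
    using Part by (simp add: algebra_simps)
next
  case (Node t u)
  have 1: "(\<Sum>s\<in>syms t. \<mu> s * real (length (enc (Node t u) s)))
      = (\<Sum>s\<in>syms t. \<mu> s * real (length (False # enc t s)))"
    by (intro sum.cong) auto
  have 2: "(\<Sum>s\<in>syms u. \<mu> s * real (length (enc (Node t u) s)))
      = (\<Sum>s\<in>syms u. \<mu> s * real (length (True # enc u s)))"
    using Node by (intro sum.cong) auto
  have 3: "(\<Sum>s\<in>syms t \<union> syms u. f s) = sum f (syms t) + sum f (syms u)" for f :: "_ \<Rightarrow> real"
    using Node by (intro sum.union_disjoint) auto
  have 4: "sum \<mu> (partials t \<union> partials u) = sum \<mu> (partials t) + sum \<mu> (partials u)"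
    using Node partials_psubset[of t] partials_psubset[of u] by (intro sum.union_disjoint) auto
  show ?case
    using Node
    by (simp only: aifv_tree.set 3 1 2 sum_length_Cons finite_syms tree_cost.simps partials.simps 4
        good.simps) (simp add: algebra_simps)
qed simp

lemma pair_cost_eq:
  assumes "good (Node t u)"
  shows "pair_cost \<mu> h (t, u) = (\<Sum>s\<in>syms t \<union> syms u. \<mu> s * real (length (enc1 (t, u) s)))
    + h * sum \<mu> (partials t \<union> partials u)"
proof -
  have 1: "(\<Sum>s\<in>syms t. \<mu> s * real (length (enc1 (t, u) s)))
      = (\<Sum>s\<in>syms t. \<mu> s * real (length (False # True # enc t s)))"
    by (intro sum.cong) (auto simp: enc1_def)
  have 2: "(\<Sum>s\<in>syms u. \<mu> s * real (length (enc1 (t, u) s)))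
      = (\<Sum>s\<in>syms u. \<mu> s * real (length (True # enc u s)))"
    using assms by (intro sum.cong) (auto simp: enc1_def)
  have 3: "(\<Sum>s\<in>syms t \<union> syms u. f s) = sum f (syms t) + sum f (syms u)" for f :: "_ \<Rightarrow> real"
    using assms by (intro sum.union_disjoint) auto
  have 4: "sum \<mu> (partials t \<union> partials u) = sum \<mu> (partials t) + sum \<mu> (partials u)"
    using assms partials_psubset[of t] partials_psubset[of u] by (intro sum.union_disjoint) auto
  have 5: "good t" "good u" using assms by auto
  show ?thesis
    by (simp only: pair_cost_def fst_conv snd_conv 3 1 2 4 sum_length_Cons finite_syms tree_cost_eq[OF 5(1)] tree_cost_eq[OF 5(2)])
      (simp add: algebra_simps)
qed

text \<open>Giving up 00 costs at most one bit. A \<open>Node\<close> hangs its left part below 01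
  instead of 0, one bit deeper; a \<open>Part\<close> moves its subtree from 00 to 01 at equal depth
  and its own symbol from the root to the node 1.\<close>

lemma pair_of_tree:
  assumes "t \<in> trees_on X" "card X \<ge> 2" "\<And>s. 0 \<le> \<mu> s" "0 \<le> h"
  shows "\<exists>p \<in> pairs_on X. pair_cost \<mu> h p \<le> tree_cost \<mu> h t + sum \<mu> X"
proof (cases t)
  case (Leaf s)
  then show ?thesis using assms by (auto simp: trees_on_def)
next
  case (Part s u)
  have "pair_cost \<mu> h (u, Leaf s) = 2 * sum \<mu> (syms u) + \<mu> s + tree_cost \<mu> h u"
    by (simp add: pair_cost_def)
  moreover have "sum \<mu> X = \<mu> s + sum \<mu> (syms u)"
    using assms Part by (auto simp: trees_on_def)
  moreover have "0 \<le> h * \<mu> s" "0 \<le> sum \<mu> (syms u)"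
    using assms by (auto intro: sum_nonneg)
  ultimately have "pair_cost \<mu> h (u, Leaf s) \<le> tree_cost \<mu> h t + sum \<mu> X"
    using Part by simp
  moreover have "(u, Leaf s) \<in> pairs_on X"
    using assms Part by (auto simp: trees_on_def pairs_on_def)
  ultimately show ?thesis by blast
next
  case (Node u v)
  have "sum \<mu> X = sum \<mu> (syms u) + sum \<mu> (syms v)"
    using assms Node by (auto simp: trees_on_def intro!: sum.union_disjoint)
  moreover have "0 \<le> sum \<mu> (syms v)"
    using assms by (auto intro: sum_nonneg)
  ultimately have "pair_cost \<mu> h (u, v) \<le> tree_cost \<mu> h t + sum \<mu> X"
    using Node by (simp add: pair_cost_def)
  moreover have "(u, v) \<in> pairs_on X"
    using assms Node by (auto simp: trees_on_def pairs_on_def)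
  ultimately show ?thesis by blast
qed

text \<open>Contracting the edge from 0 to 01 lifts the left tree by one bit and yields an ordinary
  \<open>Node\<close>.\<close>

lemma tree_of_pair:
  assumes "p \<in> pairs_on X" "\<And>s. 0 \<le> \<mu> s"
  shows "\<exists>t \<in> trees_on X. tree_cost \<mu> h t \<le> pair_cost \<mu> h p"
proof -
  have "0 \<le> sum \<mu> (syms (fst p))"
    using assms by (auto intro: sum_nonneg)
  then have "tree_cost \<mu> h (Node (fst p) (snd p)) \<le> pair_cost \<mu> h p"
    by (simp add: pair_cost_def)
  moreover have "Node (fst p) (snd p) \<in> trees_on X"
    using assms by (auto simp: trees_on_def pairs_on_def)
  ultimately show ?thesis by blast
qed

lemma trees_on_nonempty:
  assumes "finite X" "X \<noteq> {}"
  shows "trees_on X \<noteq> {}"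
  using assms
proof (induction X rule: finite_ne_induct)
  case (singleton x)
  have "Leaf x \<in> trees_on {x}" by (simp add: trees_on_def)
  then show ?case by blast
next
  case (insert x X)
  then obtain t where "t \<in> trees_on X" by blast
  with insert have "Part x t \<in> trees_on (insert x X)" by (auto simp: trees_on_def)
  then show ?case by blast
qed

section \<open>Regions of the code tree\<close>

text \<open>A symbol with codeword \<open>b\<close> whose next table can emit exactly the pairs of bits in \<open>A\<close> occupies
  the cylinders of \<open>b @ a\<close>, \<open>a \<in> A\<close>. Up to shifting bits between the codeword and \<open>A\<close>, this region is a
  whole subtree, a subtree without the grandchild \<open>[x, y]\<close>, or one grandchild below each child. The
  region is the union of the cylinders of \<open>words\<close>.\<close>
datatype item = Whole "bool list" | Three "bool list" bool bool | Diag "bool list" bool bool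

primrec item_root :: "item \<Rightarrow> bool list" where
  "item_root (Whole b) = b"
| "item_root (Three b x y) = b"
| "item_root (Diag b y z) = b"

primrec words :: "item \<Rightarrow> bool list set" where
  "words (Whole b) = {b}"
| "words (Three b x y) = {b @ [\<not> x], b @ [x, \<not> y]}"
| "words (Diag b y z) = {b @ [False, y], b @ [True, z]}"

text \<open>Codeword length plus potential of the next table. Leading bits shared by all
  continuations are moved into \<open>b\<close>, so their potential is already part of the length of
  \<open>b\<close>.\<close>

primrec item_cost :: "real \<Rightarrow> item \<Rightarrow> real" where
  "item_cost h (Whole b) = real (length b)"
| "item_cost h (Three b x y) = real (length b) + h"
| "item_cost h (Diag b y z) = real (length b) + 1"

primrec shift :: "nat \<Rightarrow> item \<Rightarrow> item" where
  "shift n (Whole b) = Whole (drop n b)"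
| "shift n (Three b x y) = Three (drop n b) x y"
| "shift n (Diag b y z) = Diag (drop n b) y z"

text \<open>Words are incomparable exactly when their cylinders are disjoint, so this is
  disjointness of the regions.\<close>

definition family :: "'s set \<Rightarrow> ('s \<Rightarrow> item) \<Rightarrow> bool" where
  "family X it \<longleftrightarrow> (\<forall>s\<in>X. \<forall>s'\<in>X. s \<noteq> s' \<longrightarrow>
     (\<forall>w\<in>words (it s). \<forall>w'\<in>words (it s'). w \<parallel> w'))"

definition family_cost :: "('s \<Rightarrow> real) \<Rightarrow> real \<Rightarrow> 's set \<Rightarrow> ('s \<Rightarrow> item) \<Rightarrow> real" where
  "family_cost \<mu> h X it = (\<Sum>s\<in>X. \<mu> s * item_cost h (it s))"

section \<open>Roots, shifts and costs of items\<close>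

lemma words_nonempty [simp]: "words it \<noteq> {}"
  by (cases it) auto

lemma prefix_branch:
  "prefix p (b @ c # u) \<Longrightarrow> prefix p (b @ d # v) \<Longrightarrow> c \<noteq> d \<Longrightarrow> prefix p b"
proof (induction b arbitrary: p)
  case Nil
  then show ?case by (cases p) auto
next
  case (Cons a b)
  then show ?case by (cases p) auto
qed

text \<open>The root is the longest common prefix of the words. Lying below a node can thus be
  checked word by word and then used to strip the whole item.\<close>

lemma prefix_root_iff: "prefix p (item_root it) \<longleftrightarrow> (\<forall>w\<in>words it. prefix p w)"
proof
  show "prefix p (item_root it) \<Longrightarrow> \<forall>w\<in>words it. prefix p w"
    by (cases it) auto
  show "\<forall>w\<in>words it. prefix p w \<Longrightarrow> prefix p (item_root it)"
  proof (cases it)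
    case (Three b x y)
    then show "\<forall>w\<in>words it. prefix p w \<Longrightarrow> prefix p (item_root it)"
      using prefix_branch[of p b "\<not> x" "[]" x "[\<not> y]"] by simp
  next
    case (Diag b y z)
    then show "\<forall>w\<in>words it. prefix p w \<Longrightarrow> prefix p (item_root it)"
      using prefix_branch[of p b False "[y]" True "[z]"] by simp
  qed simp
qed

lemma root_shift [simp]: "item_root (shift n it) = drop n (item_root it)"
  by (cases it) auto

lemma words_shift:
  "prefix p (item_root it) \<Longrightarrow> words it = (\<lambda>w. p @ w) ` words (shift (length p) it)"
  by (cases it) (auto elim!: prefixE)

lemma item_cost_shift:
  "prefix p (item_root it) \<Longrightarrow> item_cost h it = real (length p) + item_cost h (shift (length p) it)"
  by (cases it) (auto elim!: prefixE)

lemma parallel_append_same [simp]: "(p @ w) \<parallel> (p @ w') \<longleftrightarrow> w \<parallel> w'"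
  by (simp add: parallel_def)

lemma familyD:
  "\<lbrakk>family X it; s \<in> X; s' \<in> X; s \<noteq> s'; w \<in> words (it s); w' \<in> words (it s')\<rbrakk> \<Longrightarrow> w \<parallel> w'"
  unfolding family_def by blast

lemma family_subset: "family X it \<Longrightarrow> Y \<subseteq> X \<Longrightarrow> family Y it"
  unfolding family_def by blast

lemma family_shift:
  assumes "family X it" "\<And>s. s \<in> X \<Longrightarrow> prefix p (item_root (it s))"
  shows "family X (\<lambda>s. shift (length p) (it s))"
  unfolding family_def
proof (intro ballI impI)
  fix s s' w w'
  assume *: "s \<in> X" "s' \<in> X" "s \<noteq> s'"
    "w \<in> words (shift (length p) (it s))" "w' \<in> words (shift (length p) (it s'))"
  then have "p @ w \<in> words (it s)" "p @ w' \<in> words (it s')"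
    using assms(2) words_shift by blast+
  then have "(p @ w) \<parallel> (p @ w')"
    using assms(1) * unfolding family_def by blast
  then show "w \<parallel> w'" by simp
qed

lemma family_cost_shift:
  assumes "\<And>s. s \<in> X \<Longrightarrow> prefix p (item_root (it s))"
  shows "family_cost \<mu> h X it
    = real (length p) * sum \<mu> X + family_cost \<mu> h X (\<lambda>s. shift (length p) (it s))"
proof -
  have "family_cost \<mu> h X it
      = (\<Sum>s\<in>X. \<mu> s * (real (length p) + item_cost h (shift (length p) (it s))))"
    unfolding family_cost_def using assms item_cost_shift by (intro sum.cong) auto
  then show ?thesis
    by (simp add: family_cost_def distrib_left sum.distrib sum_distrib_right mult.commute)
qed

lemma family_cost_union:
  assumes "finite X" "finite Y" "X \<inter> Y = {}"
  shows "family_cost \<mu> h (X \<union> Y) it = family_cost \<mu> h X it + family_cost \<mu> h Y it"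
  unfolding family_cost_def using assms by (rule sum.union_disjoint)

lemma item_cost_nonneg: "0 \<le> h \<Longrightarrow> 0 \<le> item_cost h it"
  by (cases it) auto

lemma family_cost_nonneg:
  assumes "\<And>s. 0 \<le> \<mu> s" "0 \<le> h"
  shows "0 \<le> family_cost \<mu> h X it"
  unfolding family_cost_def using assms item_cost_nonneg by (intro sum_nonneg mult_nonneg_nonneg) auto

lemma parallel_three: "w \<parallel> [\<not> x] \<Longrightarrow> w \<parallel> [x, \<not> y] \<Longrightarrow> prefix [x, y] w"
  \<comment> \<open>The rule \<open>remdups_adj.cases\<close> separates lists of length 0, 1 and at
    least 2, which is the depth that matters here.\<close>
  by (cases x; cases y; cases w rule: remdups_adj.cases) (simp_all add: parallel_def)

lemma parallel_diag:
  "w \<parallel> [False, y] \<Longrightarrow> w \<parallel> [True, z] \<Longrightarrow> prefix [False, \<not> y] w \<or> prefix [True, \<not> z] w"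
  by (cases y; cases z; cases w rule: remdups_adj.cases) (auto simp: parallel_def)

text \<open>A nonempty root fixes the first bit of all words and thereby the grandchild. With an
  empty root, \<open>Whole\<close> and \<open>Three\<close> have a word of length below 2, so only
  \<open>Diag\<close> remains.\<close>

lemma root_diag_cases:
  assumes "\<And>w. w \<in> words it \<Longrightarrow> prefix [False, y] w \<or> prefix [True, z] w"
  shows "prefix [False, y] (item_root it) \<or> prefix [True, z] (item_root it) \<or> it = Diag [] y z"
proof (cases "item_root it")
  case Nil
  moreover have "\<forall>w\<in>words it. prefix [False, y] w \<or> prefix [True, z] w" using assms by blast
  ultimately have "it = Diag [] y z" by (cases it) simp_all
  then show ?thesis by simp
next
  case (Cons c b)
  have hd: "prefix [c] w" if "w \<in> words it" for w
    using that prefix_root_iff[of "[c]" it] Cons by auto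
  have "prefix [c, if c then z else y] w" if "w \<in> words it" for w
    using assms[OF that] hd[OF that] by (cases c; cases w) auto
  then have "prefix [c, if c then z else y] (item_root it)"
    by (simp add: prefix_root_iff)
  then show ?thesis by (cases c) auto
qed

lemma split_by_head:
  assumes "\<forall>s\<in>X. prefix (False # p) (r s) \<or> prefix (True # q) (r s)"
  shows "\<exists>Y Z. X = Y \<union> Z \<and> Y \<inter> Z = {} \<and>
    (\<forall>s\<in>Y. prefix (False # p) (r s)) \<and> (\<forall>s\<in>Z. prefix (True # q) (r s))"
proof (intro exI conjI)
  let ?Y = "{s \<in> X. prefix (False # p) (r s)}" and ?Z = "{s \<in> X. prefix (True # q) (r s)}"
  show "X = ?Y \<union> ?Z" using assms by auto
  show "?Y \<inter> ?Z = {}" by (auto simp: prefix_def)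
qed auto

text \<open>Each half brings one bit more than the union has to keep, and the edges of a new
  \<open>Node\<close> spend it. If one half is empty, no \<open>Node\<close> is built and the bit is
  saved, as masses are nonnegative.\<close>

lemma join_trees:
  fixes k :: real
  assumes "finite Y" "finite Z" "Y \<inter> Z = {}" "Y \<union> Z \<noteq> {}" and \<mu>: "\<And>s. 0 \<le> \<mu> s"
    and Y: "Y \<noteq> {} \<Longrightarrow>
      \<exists>t \<in> trees_on Y. tree_cost \<mu> h t + (k + 1) * sum \<mu> Y \<le> family_cost \<mu> h Y it"
    and Z: "Z \<noteq> {} \<Longrightarrow>
      \<exists>t \<in> trees_on Z. tree_cost \<mu> h t + (k + 1) * sum \<mu> Z \<le> family_cost \<mu> h Z it"
  shows "\<exists>t \<in> trees_on (Y \<union> Z).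
    tree_cost \<mu> h t + k * sum \<mu> (Y \<union> Z) \<le> family_cost \<mu> h (Y \<union> Z) it"
proof -
  have nn: "0 \<le> sum \<mu> Y" "0 \<le> sum \<mu> Z" by (simp_all add: sum_nonneg \<mu>)
  consider "Y = {}" "Z \<noteq> {}" | "Z = {}" "Y \<noteq> {}" | "Y \<noteq> {}" "Z \<noteq> {}"
    using assms(4) by blast
  then show ?thesis
  proof cases
    case 1
    then obtain t where "t \<in> trees_on Z"
      "tree_cost \<mu> h t + (k + 1) * sum \<mu> Z \<le> family_cost \<mu> h Z it" using Z by blast
    with 1 nn show ?thesis by (auto simp: distrib_right intro!: bexI[of _ t])
  next
    case 2
    then obtain t where "t \<in> trees_on Y"
      "tree_cost \<mu> h t + (k + 1) * sum \<mu> Y \<le> family_cost \<mu> h Y it" using Y by blast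
    with 2 nn show ?thesis by (auto simp: distrib_right intro!: bexI[of _ t])
  next
    case 3
    obtain t where t: "t \<in> trees_on Y"
      "tree_cost \<mu> h t + (k + 1) * sum \<mu> Y \<le> family_cost \<mu> h Y it" using Y 3 by blast
    obtain u where u: "u \<in> trees_on Z"
      "tree_cost \<mu> h u + (k + 1) * sum \<mu> Z \<le> family_cost \<mu> h Z it" using Z 3 by blast
    have "Node t u \<in> trees_on (Y \<union> Z)" using t u assms by (auto simp: trees_on_def)
    moreover have "tree_cost \<mu> h (Node t u) + k * sum \<mu> (Y \<union> Z) \<le> family_cost \<mu> h (Y \<union> Z) it"
      using t u family_cost_union[OF assms(1-3), of \<mu> h it] sum.union_disjoint[OF assms(1-3), of \<mu>]
      by (simp add: trees_on_def distrib_left distrib_right)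
    ultimately show ?thesis by blast
  qed
qed

text \<open>Families without an item at the root split by the first bit. An item at the root
  confines all others: \<open>Whole\<close> excludes them; \<open>Three\<close> leaves one
  grandchild, which gives a \<open>Part\<close>; \<open>Diag\<close> leaves one grandchild below
  each child. These two are gathered below one child, and the other child goes to the
  \<open>Diag\<close> symbol, whose surcharge 1 pays for it.\<close>

theorem family_tree:
  assumes "finite X" "X \<noteq> {}" "family X it" and \<mu>: "\<And>s. 0 \<le> \<mu> s" and h: "0 \<le> h"
  shows "\<exists>t \<in> trees_on X. tree_cost \<mu> h t \<le> family_cost \<mu> h X it"
  using assms(1-3)
proof (induction "\<Sum>s\<in>X. length (item_root (it s))" arbitrary: X it rule: less_induct)
  case less
  \<comment> \<open>The induction hypothesis below a common nonempty \<open>p\<close>: removing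
    \<open>p\<close> shortens every root, and the removed bits stay as a surcharge on the mass of
    \<open>Y\<close>.\<close>
  have strip: "\<exists>t \<in> trees_on Y. tree_cost \<mu> h t + real (length p) * sum \<mu> Y \<le> family_cost \<mu> h Y it"
    if Y: "Y \<subseteq> X" "Y \<noteq> {}" "p \<noteq> []" "\<And>s. s \<in> Y \<Longrightarrow> prefix p (item_root (it s))" for Y p
  proof -
    have fin: "finite Y" using Y less.prems finite_subset by blast
    have "(\<Sum>s\<in>Y. length (item_root (shift (length p) (it s)))) < (\<Sum>s\<in>Y. length (item_root (it s)))"
    proof (rule sum_strict_mono[OF fin Y(2)])
      fix s assume "s \<in> Y"
      then have "length p \<le> length (item_root (it s))" using Y(4) prefix_length_le by blast
      moreover have "length p > 0" using Y(3) by simp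
      ultimately show "length (item_root (shift (length p) (it s))) < length (item_root (it s))"
        by (simp del: length_greater_0_conv)
    qed
    also have "\<dots> \<le> (\<Sum>s\<in>X. length (item_root (it s)))"
      using Y less.prems by (intro sum_mono2) auto
    finally have "\<exists>t \<in> trees_on Y. tree_cost \<mu> h t \<le> family_cost \<mu> h Y (\<lambda>s. shift (length p) (it s))"
      using family_shift[of Y it p] family_subset[OF less.prems(3) Y(1)] Y fin
      by (intro less.hyps) auto
    then show ?thesis using family_cost_shift[of Y p it \<mu> h] Y(4) by auto
  qed
  show ?case
  proof (cases "\<exists>s\<in>X. item_root (it s) = []")
    case False
    have head: "\<forall>s\<in>X. prefix [False] (item_root (it s)) \<or> prefix [True] (item_root (it s))"
    proof
      fix s assume "s \<in> X"
      with False show "prefix [False] (item_root (it s)) \<or> prefix [True] (item_root (it s))"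
        by (cases "item_root (it s)") auto
    qed
    obtain Y Z where YZ: "X = Y \<union> Z" "Y \<inter> Z = {}"
      "\<forall>s\<in>Y. prefix [False] (item_root (it s))" "\<forall>s\<in>Z. prefix [True] (item_root (it s))"
      using split_by_head[OF head] by (elim exE conjE) (rule that)
    \<comment> \<open>The summand with factor 0 matches \<open>join_trees\<close> with
      \<open>k = 0\<close>.\<close>
    have "\<exists>t\<in>trees_on X. tree_cost \<mu> h t + 0 * sum \<mu> X \<le> family_cost \<mu> h X it"
      unfolding YZ(1)
    proof (rule join_trees)
      show "finite Y" "finite Z" "Y \<union> Z \<noteq> {}" "Y \<inter> Z = {}" using less.prems YZ by auto
      show "\<exists>t\<in>trees_on Y. tree_cost \<mu> h t + (0 + 1) * sum \<mu> Y \<le> family_cost \<mu> h Y it" if "Y \<noteq> {}"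
        using strip[of Y "[False]"] that YZ by simp
      show "\<exists>t\<in>trees_on Z. tree_cost \<mu> h t + (0 + 1) * sum \<mu> Z \<le> family_cost \<mu> h Z it" if "Z \<noteq> {}"
        using strip[of Z "[True]"] that YZ by simp
    qed (rule \<mu>)
    then show ?thesis by simp
  next
    case True
    then obtain s where s: "s \<in> X" "item_root (it s) = []" by blast
    define R where "R = X - {s}"
    have X: "X = insert s R" "s \<notin> R" and finR: "finite R" using s less.prems by (auto simp: R_def)
    have par: "w' \<parallel> w" if "s' \<in> R" "w \<in> words (it s)" "w' \<in> words (it s')" for s' w w'
      using that X by (intro familyD[OF less.prems(3), of s' s]) auto
    have cost: "family_cost \<mu> h X it = \<mu> s * item_cost h (it s) + family_cost \<mu> h R it"
      using X finR by (simp add: family_cost_def)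
    show ?thesis
    proof (cases "R = {}")
      case True
      then have "Leaf s \<in> trees_on X" using X by (simp add: trees_on_def)
      then show ?thesis using family_cost_nonneg[of \<mu> h X it] \<mu> h by (auto intro!: bexI[of _ "Leaf s"])
    next
      case False
      show ?thesis
      proof (cases "it s")
        case (Whole b)
        obtain s' w' where "s' \<in> R" "w' \<in> words (it s')"
          using False words_nonempty by (metis all_not_in_conv)
        then have "w' \<parallel> []" using par s Whole by auto
        then show ?thesis by simp
      next
        case (Three b x y)
        have "prefix [x, y] (item_root (it s'))" if "s' \<in> R" for s'
          unfolding prefix_root_iff using par[OF that] s Three by (auto intro!: parallel_three)
        then obtain t where t: "t \<in> trees_on R" "tree_cost \<mu> h t + 2 * sum \<mu> R \<le> family_cost \<mu> h R it"
          using strip[of R "[x, y]"] False X by auto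
        have "Part s t \<in> trees_on X" using t X by (auto simp: trees_on_def)
        moreover have "tree_cost \<mu> h (Part s t) \<le> family_cost \<mu> h X it"
          using t cost s Three by (auto simp: trees_on_def algebra_simps)
        ultimately show ?thesis by blast
      next
        case (Diag b y z)
        have R: "prefix [False, \<not> y] (item_root (it s')) \<or> prefix [True, \<not> z] (item_root (it s'))
            \<or> it s' = Diag [] (\<not> y) (\<not> z)" if "s' \<in> R" for s'
          using par[OF that] s Diag by (intro root_diag_cases parallel_diag) auto
        have cost': "family_cost \<mu> h X it = \<mu> s + family_cost \<mu> h R it"
          using cost s Diag by simp
        show ?thesis
        proof (cases "\<exists>s'\<in>R. it s' = Diag [] (\<not> y) (\<not> z)")
          case True
          then obtain s' where s': "s' \<in> R" "it s' = Diag [] (\<not> y) (\<not> z)" by blast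
          \<comment> \<open>Two complementary \<open>Diag\<close> items occupy all four
            grandchildren, so no word of a third item finds a free one.\<close>
          have "R = {s'}"
          proof (rule ccontr)
            assume "R \<noteq> {s'}"
            then obtain s'' where s'': "s'' \<in> R" "s'' \<noteq> s'" using s' by blast
            have "w'' \<parallel> w" if "w'' \<in> words (it s'')" "w \<in> words (it s')" for w w''
              using that X s' s'' by (intro familyD[OF less.prems(3), of s'' s']) auto
            then have "prefix [False, y] w \<or> prefix [True, z] w" if "w \<in> words (it s'')" for w
              using parallel_diag[of w "\<not> y" "\<not> z"] that s' by auto
            moreover have "prefix [False, \<not> y] w \<or> prefix [True, \<not> z] w" if "w \<in> words (it s'')" for w
              using parallel_diag[of w y z] that par[OF s''(1)] s Diag by auto
            moreover obtain w where "w \<in> words (it s'')" using words_nonempty by blast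
            ultimately have "(prefix [False, y] w \<or> prefix [True, z] w)
              \<and> (prefix [False, \<not> y] w \<or> prefix [True, \<not> z] w)" by blast
            then show False by (auto simp: prefix_def)
          qed
          then have "Node (Leaf s) (Leaf s') \<in> trees_on X" using X by (auto simp: trees_on_def)
          moreover have "tree_cost \<mu> h (Node (Leaf s) (Leaf s')) \<le> family_cost \<mu> h X it"
            using cost' s' \<open>R = {s'}\<close> by (simp add: family_cost_def)
          ultimately show ?thesis by blast
        next
          case nodiag: False
          have head: "\<forall>s'\<in>R. prefix [False, \<not> y] (item_root (it s'))
              \<or> prefix [True, \<not> z] (item_root (it s'))"
            using R nodiag by blast
          obtain Y Z where YZ: "R = Y \<union> Z" "Y \<inter> Z = {}"
            "\<forall>s\<in>Y. prefix [False, \<not> y] (item_root (it s))"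
            "\<forall>s\<in>Z. prefix [True, \<not> z] (item_root (it s))"
            using split_by_head[OF head]
            by (elim exE conjE) (rule that)
          have sub: "Y \<subseteq> X" "Z \<subseteq> X" using YZ X by auto
          \<comment> \<open>Both free grandchildren are two bits deep; joining with
            \<open>k = 1\<close> leaves one bit, enough to hang the joint tree below a single
            child.\<close>
          have "\<exists>u\<in>trees_on R. tree_cost \<mu> h u + 1 * sum \<mu> R \<le> family_cost \<mu> h R it"
            unfolding YZ(1)
          proof (rule join_trees)
            show "finite Y" "finite Z" "Y \<union> Z \<noteq> {}" "Y \<inter> Z = {}" using finR False YZ by auto
            show "\<exists>t\<in>trees_on Y. tree_cost \<mu> h t + (1 + 1) * sum \<mu> Y \<le> family_cost \<mu> h Y it"
              if "Y \<noteq> {}"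
              using strip[of Y "[False, \<not> y]"] that YZ sub by simp
            show "\<exists>t\<in>trees_on Z. tree_cost \<mu> h t + (1 + 1) * sum \<mu> Z \<le> family_cost \<mu> h Z it"
              if "Z \<noteq> {}"
              using strip[of Z "[True, \<not> z]"] that YZ sub by simp
          qed (rule \<mu>)
          then obtain u where u: "u \<in> trees_on R" "tree_cost \<mu> h u + sum \<mu> R \<le> family_cost \<mu> h R it"
            by auto
          have "Node (Leaf s) u \<in> trees_on X" using u X by (auto simp: trees_on_def)
          moreover have "tree_cost \<mu> h (Node (Leaf s) u) \<le> family_cost \<mu> h X it"
            using u cost' by (auto simp: trees_on_def)
          ultimately show ?thesis by blast
        qed
      qed
    qed
  qed
qed

lemma family_strip:
  assumes "finite X" "X \<noteq> {}" "family X it" and \<mu>: "\<And>s. 0 \<le> \<mu> s" and h: "0 \<le> h"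
    and p: "\<And>s. s \<in> X \<Longrightarrow> prefix p (item_root (it s))"
  shows "\<exists>t \<in> trees_on X. tree_cost \<mu> h t + real (length p) * sum \<mu> X \<le> family_cost \<mu> h X it"
  using family_tree[of X "\<lambda>s. shift (length p) (it s)" \<mu> h] assms
    family_shift[of X it p] family_cost_shift[of X p it \<mu> h] by auto

text \<open>Below the child \<open>x\<close> one grandchild is the forbidden \<open>[x, y]\<close>
  and the other is taken by the diagonal, so \<open>w\<close> must use the free grandchild of the
  other child.\<close>

lemma parallel_three_diag:
  assumes "w \<parallel> [False, y\<^sub>1]" "w \<parallel> [True, y\<^sub>2]" "w \<parallel> [x, y]" "[False, y\<^sub>1] \<parallel> [x, y]" "[True, y\<^sub>2] \<parallel> [x, y]"
  shows "prefix [\<not> x, \<not> (if x then y\<^sub>1 else y\<^sub>2)] w"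
  using assms by (cases x; cases y; cases y\<^sub>1; cases y\<^sub>2; cases w rule: remdups_adj.cases)
    (auto simp: parallel_def)

lemma parallel_same_head: "prefix [x] w \<Longrightarrow> w \<parallel> [x, y] \<Longrightarrow> prefix [x, \<not> y] w"
  by (cases x; cases y; cases w rule: remdups_adj.cases) (auto simp: parallel_def)

text \<open>The forbidden \<open>[x, y]\<close> takes the role of 00. Only a \<open>Diag\<close> can
  sit at the root: the hole of a \<open>Three\<close> would be \<open>[x, y]\<close> itself, with no
  room for a second symbol. The \<open>Diag\<close> symbol gets the node 1 and the others the
  subtree at 01. Without an item at the root, all items lie below \<open>[x, \<not> y]\<close> or
  \<open>[\<not> x]\<close>, which correspond to 01 and 1.\<close>

theorem family_pair:
  assumes fin: "finite X" and card: "2 \<le> card X" and fam: "family X it"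
    and \<mu>: "\<And>s. 0 \<le> \<mu> s" and h: "0 \<le> h"
    and avoid: "\<And>s w. s \<in> X \<Longrightarrow> w \<in> words (it s) \<Longrightarrow> w \<parallel> [x, y]"
  shows "\<exists>p \<in> pairs_on X. pair_cost \<mu> h p \<le> family_cost \<mu> h X it"
proof (cases "\<exists>s\<in>X. item_root (it s) = []")
  case True
  then obtain s where s: "s \<in> X" "item_root (it s) = []" by blast
  define R where "R = X - {s}"
  have X: "X = insert s R" "s \<notin> R" and finR: "finite R" using s fin by (auto simp: R_def)
  have R: "R \<noteq> {}" using card X by auto
  have par: "w' \<parallel> w" if "s' \<in> R" "w \<in> words (it s)" "w' \<in> words (it s')" for s' w w'
    using that X by (intro familyD[OF fam, of s' s]) auto
  obtain s' w' where w': "s' \<in> R" "w' \<in> words (it s')"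
    using R words_nonempty by (metis all_not_in_conv)
  show ?thesis
  proof (cases "it s")
    case (Whole b)
    then show ?thesis using s avoid[OF s(1)] by simp
  next
    case (Three b x' y')
    then have it: "words (it s) = {[\<not> x'], [x', \<not> y']}" using s by simp
    have "[\<not> x'] \<parallel> [x, y]" "[x', \<not> y'] \<parallel> [x, y]"
      by (rule avoid[OF s(1)], simp add: it)+
    then have "x' = x" "y' = y"
      by (cases x; cases x'; cases y; cases y'; simp add: parallel_def)+
    moreover have "w' \<parallel> [\<not> x']" "w' \<parallel> [x', \<not> y']"
      by (rule par[OF w'(1) _ w'(2)], simp add: it)+
    then have "prefix [x', y'] w'" by (rule parallel_three)
    moreover have "w' \<parallel> [x, y]" using avoid[of s' w'] w' X by simp
    ultimately show ?thesis by (simp add: parallel_def)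
  next
    case (Diag b y\<^sub>1 y\<^sub>2)
    let ?p = "[\<not> x, \<not> (if x then y\<^sub>1 else y\<^sub>2)]"
    have "prefix ?p (item_root (it s''))" if "s'' \<in> R" for s''
      unfolding prefix_root_iff
    proof
      fix w assume w: "w \<in> words (it s'')"
      have it: "words (it s) = {[False, y\<^sub>1], [True, y\<^sub>2]}" using s Diag by simp
      have "w \<parallel> [False, y\<^sub>1]" "w \<parallel> [True, y\<^sub>2]"
        by (rule par[OF that _ w], simp add: it)+
      moreover have "[False, y\<^sub>1] \<parallel> [x, y]" "[True, y\<^sub>2] \<parallel> [x, y]"
        by (rule avoid[OF s(1)], simp add: it)+
      moreover have "w \<parallel> [x, y]" using avoid[of s'' w] that X w by simp
      ultimately show "prefix ?p w" by (intro parallel_three_diag)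
    qed
    then obtain t where t: "t \<in> trees_on R"
      "tree_cost \<mu> h t + 2 * sum \<mu> R \<le> family_cost \<mu> h R it"
      using family_strip[of R it \<mu> h ?p] finR R family_subset[OF fam, of R] X \<mu> h by auto
    have "(t, Leaf s) \<in> pairs_on X" using t X by (auto simp: trees_on_def pairs_on_def)
    moreover have "family_cost \<mu> h X it = \<mu> s + family_cost \<mu> h R it"
      using X finR s Diag by (simp add: family_cost_def)
    then have "pair_cost \<mu> h (t, Leaf s) \<le> family_cost \<mu> h X it"
      using t by (simp add: pair_cost_def trees_on_def)
    ultimately show ?thesis by blast
  qed
next
  case False
  define Y where "Y = {s \<in> X. prefix [x, \<not> y] (item_root (it s))}"
  define Z where "Z = {s \<in> X. prefix [\<not> x] (item_root (it s))}"
  have "prefix [x, \<not> y] (item_root (it s)) \<or> prefix [\<not> x] (item_root (it s))" if "s \<in> X" for s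
  proof (cases "prefix [x] (item_root (it s))")
    case True
    then have "prefix [x, \<not> y] (item_root (it s))"
      unfolding prefix_root_iff using avoid[OF that] parallel_same_head by blast
    then show ?thesis by simp
  next
    case nx: False
    then show ?thesis using False that by (cases "item_root (it s)") auto
  qed
  then have X: "X = Y \<union> Z" "Y \<inter> Z = {}" by (auto simp: Y_def Z_def prefix_def)
  have sub: "Y \<subseteq> X" "Z \<subseteq> X" by (auto simp: Y_def Z_def)
  have fins: "finite Y" "finite Z" using sub fin finite_subset by auto
  have pY: "prefix [x, \<not> y] (item_root (it s))" if "s \<in> Y" for s using that by (simp add: Y_def)
  have pZ: "prefix [\<not> x] (item_root (it s))" if "s \<in> Z" for s using that by (simp add: Z_def)
  have Y: "\<exists>t\<in>trees_on Y. tree_cost \<mu> h t + 2 * sum \<mu> Y \<le> family_cost \<mu> h Y it" if "Y \<noteq> {}"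
    using family_strip[of Y it \<mu> h "[x, \<not> y]"] fins that family_subset[OF fam sub(1)] \<mu> h pY by simp
  have Z: "\<exists>t\<in>trees_on Z. tree_cost \<mu> h t + sum \<mu> Z \<le> family_cost \<mu> h Z it" if "Z \<noteq> {}"
    using family_strip[of Z it \<mu> h "[\<not> x]"] fins that family_subset[OF fam sub(2)] \<mu> h pZ by simp
  show ?thesis
  proof (cases "Y \<noteq> {} \<and> Z \<noteq> {}")
    case True
    then obtain t u where t: "t \<in> trees_on Y" "tree_cost \<mu> h t + 2 * sum \<mu> Y \<le> family_cost \<mu> h Y it"
      and u: "u \<in> trees_on Z" "tree_cost \<mu> h u + sum \<mu> Z \<le> family_cost \<mu> h Z it"
      using Y Z by blast
    have "(t, u) \<in> pairs_on X" using t u X by (auto simp: trees_on_def pairs_on_def)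
    moreover have "pair_cost \<mu> h (t, u) \<le> family_cost \<mu> h X it"
      using t u family_cost_union[OF fins X(2), of \<mu> h it] X(1)
      by (simp add: pair_cost_def trees_on_def)
    ultimately show ?thesis by blast
  next
    case False
    have "X \<noteq> {}" using card by auto
    moreover have "0 \<le> sum \<mu> X" by (simp add: sum_nonneg \<mu>)
    \<comment> \<open>Only one of \<open>Y\<close> and \<open>Z\<close> is inhabited, so everything
      hangs at least one bit deep, and this bit pays for \<open>pair_of_tree\<close>.\<close>
    ultimately have "\<exists>t\<in>trees_on X. tree_cost \<mu> h t + sum \<mu> X \<le> family_cost \<mu> h X it"
      using False X Y Z by fastforce
    then obtain t where t: "t \<in> trees_on X" "tree_cost \<mu> h t + sum \<mu> X \<le> family_cost \<mu> h X it"
      by blast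
    obtain p where "p \<in> pairs_on X" "pair_cost \<mu> h p \<le> tree_cost \<mu> h t + sum \<mu> X"
      using pair_of_tree[of t X \<mu> h] t(1) card \<mu> h by blast
    then show ?thesis using t(2) by (intro bexI[of _ p]) auto
  qed
qed

section \<open>The potential of a code table\<close>

definition bits2 :: "bool list set" where
  "bits2 = {d. length d = 2}"

lemma bits2_eq: "bits2 = {[False, False], [False, True], [True, False], [True, True]}"
  by (auto simp: bits2_def length_Suc_conv numeral_2_eq_2)

definition pot :: "real \<Rightarrow> bool list set \<Rightarrow> real" where
  "pot h A = (if card A = 1 then 2 else if card A = 2 then 1 else if card A = 3 then h else 0)"

lemma bits2_subset_cases:
  assumes "A \<subseteq> bits2" "A \<noteq> {}"
  obtains (single) x y where "A = {[x, y]}"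
  | (half) x where "A = {[x, False], [x, True]}"
  | (diag) y z where "A = {[False, y], [True, z]}"
  | (three) x y where "A = bits2 - {[x, y]}"
  | (full) "A = bits2"
proof -
  \<comment> \<open>\<open>E\<close> rebuilds a subset from four truth values, so the classification
    of the 15 nonempty subsets (4 + 2 + 4 + 4 + 1 by shape) becomes a finite check.\<close>
  define E where "E a b c d = (if a then {[False, False]} else {}) \<union> (if b then {[False, True]} else {})
      \<union> (if c then {[True, False]} else {}) \<union> (if d then {[True, True]} else {})" for a b c d
  have *: "A = E ([False, False] \<in> A) ([False, True] \<in> A) ([True, False] \<in> A) ([True, True] \<in> A)"
    using assms(1) unfolding bits2_eq E_def by auto
  have "(\<exists>x y. E a b c d = {[x, y]}) \<or> (\<exists>x. E a b c d = {[x, False], [x, True]}) \<or>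
     (\<exists>y z. E a b c d = {[False, y], [True, z]}) \<or> (\<exists>x y. E a b c d = bits2 - {[x, y]}) \<or> E a b c d = bits2"
    if "E a b c d \<noteq> {}" for a b c d
    using that unfolding bits2_eq E_def ex_bool_eq
    by (cases a; cases b; cases c; cases d) (simp_all add: insert_Diff_if insert_commute)
  from this[of "[False, False] \<in> A" "[False, True] \<in> A" "[True, False] \<in> A" "[True, True] \<in> A",
    unfolded *[symmetric], OF assms(2)]
  show ?thesis by (elim disjE exE) (rule that, assumption)+
qed

lemma pot_simps:
  "pot h {[x, y]} = 2" "pot h {[x, False], [x, True]} = 1" "pot h {[False, y], [True, z]} = 1"
  "pot h (bits2 - {[x, y]}) = h" "pot h bits2 = 0"
proof -
  have "card bits2 = 4" by (simp add: bits2_eq)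
  moreover have "card (bits2 - {[x, y]}) = 3"
    using calculation by (subst card_Diff_singleton) (auto simp: bits2_def)
  ultimately show "pot h {[x, y]} = 2" "pot h {[x, False], [x, True]} = 1"
    "pot h {[False, y], [True, z]} = 1" "pot h (bits2 - {[x, y]}) = h" "pot h bits2 = 0"
    by (simp_all add: pot_def)
qed

text \<open>A single pair or a common first bit strips off as a prefix, and since the total mass is
  1 each stripped bit is worth 1. Two pairs beginning differently put all items two bits deep, and
  joining the halves spends only one of these bits. Three pairs are the case of
  \<open>family_pair\<close>.\<close>

theorem family_bound:
  assumes fin: "finite X" and card: "2 \<le> card X" and fam: "family X it"
    and \<mu>: "\<And>s. 0 \<le> \<mu> s" "sum \<mu> X = 1" and h: "0 \<le> h"
    and A: "A \<subseteq> bits2" "A \<noteq> {}"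
    and avoid: "\<And>s w d. s \<in> X \<Longrightarrow> w \<in> words (it s) \<Longrightarrow> d \<in> bits2 - A \<Longrightarrow> w \<parallel> d"
    and v0: "\<And>t. t \<in> trees_on X \<Longrightarrow> v \<le> tree_cost \<mu> h t"
    and v1: "\<And>p. p \<in> pairs_on X \<Longrightarrow> v + h \<le> pair_cost \<mu> h p"
  shows "v + pot h A \<le> family_cost \<mu> h X it"
proof -
  have X: "X \<noteq> {}" using card by auto
  have strip: "v + real (length p) \<le> family_cost \<mu> h X it"
    if p: "\<And>s. s \<in> X \<Longrightarrow> prefix p (item_root (it s))" for p
  proof -
    obtain t where "t \<in> trees_on X" "tree_cost \<mu> h t + real (length p) * sum \<mu> X \<le> family_cost \<mu> h X it"
      using family_strip[of X it \<mu> h p] fin X fam \<mu>(1) h p by blast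
    then show ?thesis using v0[of t] \<mu>(2) by simp
  qed
  from A show ?thesis
  proof (cases rule: bits2_subset_cases)
    case (single x y)
    have "prefix [x, y] w" if "s \<in> X" "w \<in> words (it s)" for s w
    proof -
      have "w \<parallel> [\<not> x, False]" "w \<parallel> [\<not> x, True]" "w \<parallel> [x, \<not> y]"
        using avoid[OF that] single by (auto simp: bits2_def)
      then show ?thesis
        by (cases x; cases y; cases w rule: remdups_adj.cases) (auto simp: parallel_def)
    qed
    then show ?thesis using strip[of "[x, y]"] single by (simp add: prefix_root_iff pot_simps)
  next
    case (half x)
    have "prefix [x] w" if "s \<in> X" "w \<in> words (it s)" for s w
    proof -
      have "w \<parallel> [\<not> x, False]" "w \<parallel> [\<not> x, True]"
        using avoid[OF that] half by (auto simp: bits2_def)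
      then show ?thesis
        by (cases x; cases w rule: remdups_adj.cases) (auto simp: parallel_def)
    qed
    then show ?thesis using strip[of "[x]"] half by (simp add: prefix_root_iff pot_simps)
  next
    case (diag y z)
    have w: "prefix [False, y] w \<or> prefix [True, z] w" if "s \<in> X" "w \<in> words (it s)" for s w
    proof -
      have "w \<parallel> [False, \<not> y]" "w \<parallel> [True, \<not> z]"
        using avoid[OF that] diag by (auto simp: bits2_def)
      then show ?thesis using parallel_diag by force
    qed
    \<comment> \<open>Such an item would fill all of \<open>A\<close> and leave nothing to a second
      symbol.\<close>
    have "it s \<noteq> Diag [] y z" if s: "s \<in> X" for s
    proof
      assume "it s = Diag [] y z"
      have "\<not> card X \<le> Suc 0" using card by simp
      then obtain s' where s': "s' \<in> X" "s' \<noteq> s"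
        unfolding card_le_Suc0_iff_eq[OF fin] by blast
      obtain w where "w \<in> words (it s')" using words_nonempty by blast
      with s' have "w \<parallel> [False, y]" "w \<parallel> [True, z]" "prefix [False, y] w \<or> prefix [True, z] w"
        using familyD[OF fam s'(1) s s'(2), of w] \<open>it s = Diag [] y z\<close> w by auto
      then show False by (auto simp: parallel_def)
    qed
    then have head: "\<forall>s\<in>X. prefix [False, y] (item_root (it s)) \<or> prefix [True, z] (item_root (it s))"
      using root_diag_cases w by blast
    obtain Y Z where YZ: "X = Y \<union> Z" "Y \<inter> Z = {}"
      "\<forall>s\<in>Y. prefix [False, y] (item_root (it s))" "\<forall>s\<in>Z. prefix [True, z] (item_root (it s))"
      using split_by_head[OF head] by (elim exE conjE) (rule that)
    have subY: "Y \<subseteq> X" and subZ: "Z \<subseteq> X" using YZ by auto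
    have finsY: "finite Y" and finsZ: "finite Z" using fin subY subZ finite_subset by auto
    have "\<exists>t\<in>trees_on X. tree_cost \<mu> h t + 1 * sum \<mu> X \<le> family_cost \<mu> h X it"
      unfolding YZ(1)
    proof (rule join_trees)
      show "finite Y" "finite Z" "Y \<union> Z \<noteq> {}" using fin X YZ by auto
      show "\<exists>t\<in>trees_on Y. tree_cost \<mu> h t + (1 + 1) * sum \<mu> Y \<le> family_cost \<mu> h Y it" if "Y \<noteq> {}"
        using family_strip[of Y it \<mu> h "[False, y]"] that finsY family_subset[OF fam subY] \<mu>(1) h YZ
        by simp
      show "\<exists>t\<in>trees_on Z. tree_cost \<mu> h t + (1 + 1) * sum \<mu> Z \<le> family_cost \<mu> h Z it" if "Z \<noteq> {}"
        using family_strip[of Z it \<mu> h "[True, z]"] that finsZ family_subset[OF fam subZ] \<mu>(1) h YZ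
        by simp
    qed (use YZ \<mu> in auto)
    then show ?thesis using v0 \<mu>(2) diag by (force simp: pot_simps)
  next
    case (three x y)
    have "\<exists>p\<in>pairs_on X. pair_cost \<mu> h p \<le> family_cost \<mu> h X it"
      using fin card fam \<mu>(1) h
    proof (rule family_pair)
      show "w \<parallel> [x, y]" if "s \<in> X" "w \<in> words (it s)" for s w
        using avoid[OF that] three by (auto simp: bits2_def)
    qed
    then show ?thesis using v1 three by (force simp: pot_simps)
  next
    case full
    then show ?thesis using strip[of "[]"] by (simp add: pot_simps)
  qed
qed

section \<open>From code tables to families of regions\<close>

lemma prefix_bits2:
  assumes "prefix f u" "length f + 2 \<le> length u"
  obtains a b where "prefix (f @ [a, b]) u"
proof -
  obtain v where v: "u = f @ v" using assms(1) by (auto elim: prefixE)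
  then obtain a b v' where "v = a # b # v'" using assms(2) by (cases v; cases "tl v") auto
  then show ?thesis using v that by simp
qed

text \<open>Merging sibling cylinders into their parent keeps the region but shortens its words. The
  claim therefore compares regions: it tests only words \<open>u\<close> long enough to show the
  codeword and two further bits.\<close>

lemma item_exists:
  assumes "A \<subseteq> bits2" "A \<noteq> {}"
  shows "\<exists>it. item_cost h it = real (length f) + pot h A \<and>
    (\<forall>w\<in>words it. \<forall>u. prefix w u \<longrightarrow> length f + 2 \<le> length u \<longrightarrow> (\<exists>a\<in>A. prefix (f @ a) u))"
  using assms
proof (cases rule: bits2_subset_cases)
  case (single x y)
  then show ?thesis by (intro exI[of _ "Whole (f @ [x, y])"]) (auto simp: pot_simps)
next
  case (half x)
  have "\<exists>a\<in>A. prefix (f @ a) u" if u: "prefix (f @ [x]) u" "length f + 2 \<le> length u" for u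
  proof -
    obtain a b where "prefix (f @ [a, b]) u"
      using prefix_bits2[OF append_prefixD[OF u(1)] u(2)] .
    moreover have "a = x" using calculation u(1) by (auto simp: prefix_def)
    ultimately show ?thesis using half by (cases b) auto
  qed
  then show ?thesis using half by (intro exI[of _ "Whole (f @ [x])"]) (auto simp: pot_simps)
next
  case (diag y z)
  then show ?thesis by (intro exI[of _ "Diag f y z"]) (auto simp: pot_simps)
next
  case (three x y)
  have "\<exists>a\<in>A. prefix (f @ a) u" if u: "prefix (f @ [\<not> x]) u" "length f + 2 \<le> length u" for u
  proof -
    obtain a b where "prefix (f @ [a, b]) u"
      using prefix_bits2[OF append_prefixD[OF u(1)] u(2)] .
    moreover have "a = (\<not> x)" using calculation u(1) by (auto simp: prefix_def)
    ultimately show ?thesis using three by (auto simp: bits2_def intro!: bexI[of _ "[a, b]"])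
  qed
  moreover have "\<exists>a\<in>A. prefix (f @ a) u" if "prefix (f @ [x, \<not> y]) u" for u
    using that three by (auto simp: bits2_def intro!: bexI[of _ "[x, \<not> y]"])
  ultimately show ?thesis using three by (intro exI[of _ "Three f x y"]) (auto simp: pot_simps)
next
  case full
  have "\<exists>a\<in>A. prefix (f @ a) u" if "prefix f u" "length f + 2 \<le> length u" for u
    using prefix_bits2[OF that] full by (metis (mono_tags) bits2_def length_Cons list.size(3) mem_Collect_eq numeral_2_eq_2)
  then show ?thesis using full by (intro exI[of _ "Whole f"]) (auto simp: pot_simps)
qed

lemma fstar_append: "fstar F i (x @ y) = fstar F i x @ fstar F (taustar F i x) y"
  by (induction x arbitrary: i) auto

lemma taustar_less: "wf_ct F \<Longrightarrow> i < ntab F \<Longrightarrow> taustar F i x < ntab F"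
  by (induction x arbitrary: i) (auto simp: wf_ct_def)

lemma Pset2_subset: "Pset F 2 i [] \<subseteq> bits2"
  by (auto simp: Pset_def bits2_def)

text \<open>Every table can emit one bit; a second one comes from the table reached after the source
  word that emitted the first.\<close>

lemma Pset2_nonempty:
  assumes "F \<in> F_ext" "i < ntab F"
  shows "Pset F 2 i [] \<noteq> {}"
proof -
  have one: "\<exists>x. x \<noteq> [] \<and> fstar F j x \<noteq> []" if "j < ntab F" for j
  proof -
    have "Pset F 1 j [] \<noteq> {}" using assms(1) that by (simp add: F_ext_def)
    then obtain c where "c \<in> Pset F 1 j []" by blast
    then show ?thesis unfolding Pset_def by (auto simp: prefix_def)
  qed
  obtain x where x: "x \<noteq> []" "fstar F i x \<noteq> []" using one assms(2) by blast
  obtain y where y: "fstar F (taustar F i x) y \<noteq> []"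
    using one[of "taustar F i x"] taustar_less[of F i x] assms unfolding F_ext_def by blast
  have "length (fstar F i x) > 0" "length (fstar F (taustar F i x) y) > 0"
    using x y by simp_all
  then have "length (take 2 (fstar F i (x @ y))) = 2"
    unfolding fstar_append length_take length_append by linarith
  then have "take 2 (fstar F i (x @ y)) \<in> Pset F 2 i []"
    unfolding Pset_def using x(1) take_is_prefix
    by (intro CollectI conjI exI[of _ "x @ y"]) auto
  then show ?thesis by blast
qed

lemma comparable_extension:
  fixes w w' :: "bool list"
  assumes "\<not> w \<parallel> w'"
  shows "\<exists>u. prefix w u \<and> prefix w' u \<and> n \<le> length u"
proof -
  have "prefix w w' \<or> prefix w' w" using assms by (auto simp: parallel_def)
  then show ?thesis
    using prefix_append prefix_order.trans
    by (intro exI[of _ "(if prefix w w' then w' else w) @ replicate n False"]) auto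
qed

lemma Pset_Cons:
  assumes "a \<in> Pset F k (tc F i s) []"
  obtains x where "x \<noteq> []" "hd x = s" "prefix (fc F i s @ a) (fstar F i x)"
proof -
  obtain x where "prefix a (fstar F (tc F i s) x)" using assms by (auto simp: Pset_def)
  then show ?thesis using that[of "s # x"] by simp
qed

text \<open>The common extension \<open>u\<close> makes the shorter codeword a prefix of the longer.
  If they are equal, \<open>a = a'\<close> contradicts condition (ii); otherwise \<open>s'\<close>
  and its continuation show \<open>a\<close> behind a proper extension of the codeword of
  \<open>s\<close>, against condition (i).\<close>

lemma decodable_incomparable_le:
  assumes dec: "k_bit_delay_decodable k F" and i: "i < ntab F" and "s \<noteq> s'"
    and a: "a \<in> Pset F k (tc F i s) []" and a': "a' \<in> Pset F k (tc F i s') []"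
    and u: "prefix (fc F i s @ a) u" "prefix (fc F i s' @ a') u"
    and le: "length (fc F i s) \<le> length (fc F i s')"
  shows False
proof -
  have len: "length a = k" "length a' = k" using a a' by (auto simp: Pset_def)
  have pre: "prefix (fc F i s @ a) (fc F i s' @ a')"
    using u le len by (intro prefix_length_prefix[OF u]) simp
  have pre': "prefix (fc F i s) (fc F i s')"
    using le prefix_length_prefix[OF append_prefixD[OF u(1)] append_prefixD[OF u(2)]] by blast
  show False
  proof (cases "fc F i s = fc F i s'")
    case True
    then have "a = a'" using pre len by (auto simp: prefix_def)
    then show False using dec i a a' True \<open>s \<noteq> s'\<close> unfolding k_bit_delay_decodable_def by blast
  next
    case False
    obtain x where "x \<noteq> []" "hd x = s'" "prefix (fc F i s' @ a') (fstar F i x)"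
      using Pset_Cons[OF a'] .
    then have "a \<in> Pbar F k i (fc F i s)"
      unfolding Pbar_def using len False pre pre' prefix_order.trans by (auto simp: strict_prefix_def)
    then show False using dec i a unfolding k_bit_delay_decodable_def by blast
  qed
qed

lemma decodable_incomparable:
  assumes "k_bit_delay_decodable k F" "i < ntab F" "s \<noteq> s'"
    "a \<in> Pset F k (tc F i s) []" "a' \<in> Pset F k (tc F i s') []"
    "prefix (fc F i s @ a) u" "prefix (fc F i s' @ a') u"
  shows False
  using decodable_incomparable_le[OF assms]
    decodable_incomparable_le[OF assms(1,2) assms(3)[symmetric] assms(5,4,7,6)] by linarith

text \<open>The optimality inequality for one table of an arbitrary competitor. Decodability makes
  the regions of its symbols disjoint, and its own set of first two bits is what the regions cannot
  leave.\<close>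

theorem table_bound:
  fixes F :: "'s code_tuple"
  assumes fin: "finite (UNIV :: 's set)" and card: "2 \<le> card (UNIV :: 's set)"
    and \<mu>: "\<And>s. 0 \<le> \<mu> s" "sum \<mu> UNIV = 1" and h: "0 \<le> h"
    and ext: "F \<in> F_ext" and dec: "k_bit_delay_decodable 2 F" and i: "i < ntab F"
    and v0: "\<And>t. t \<in> trees_on UNIV \<Longrightarrow> v \<le> tree_cost \<mu> h t"
    and v1: "\<And>p. p \<in> pairs_on UNIV \<Longrightarrow> v + h \<le> pair_cost \<mu> h p"
  shows "v + pot h (Pset F 2 i [])
    \<le> (\<Sum>s\<in>UNIV. \<mu> s * (real (length (fc F i s)) + pot h (Pset F 2 (tc F i s) [])))"
proof -
  let ?A = "\<lambda>s. Pset F 2 (tc F i s) []"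
  have wf: "wf_ct F" using ext by (simp add: F_ext_def)
  have ne: "?A s \<noteq> {}" for s
    using wf i by (intro Pset2_nonempty[OF ext]) (simp add: wf_ct_def)
  define P where "P s it \<longleftrightarrow> item_cost h it = real (length (fc F i s)) + pot h (?A s) \<and>
    (\<forall>w\<in>words it. \<forall>u. prefix w u \<longrightarrow> length (fc F i s) + 2 \<le> length u \<longrightarrow>
      (\<exists>a\<in>?A s. prefix (fc F i s @ a) u))" for s it
  have "\<forall>s. \<exists>it. P s it"
    unfolding P_def using item_exists[OF Pset2_subset ne] by blast
  then obtain it where it: "\<And>s. P s (it s)" by metis
  have cost: "item_cost h (it s) = real (length (fc F i s)) + pot h (?A s)" for s
    using it by (simp add: P_def)
  have long: "\<exists>a\<in>?A s. prefix (fc F i s @ a) u"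
    if "w \<in> words (it s)" "prefix w u" "length (fc F i s) + 2 \<le> length u" for s w u
    using it[of s] that by (auto simp: P_def)
  have "v + pot h (Pset F 2 i []) \<le> family_cost \<mu> h UNIV it"
    using fin card _ \<mu> h Pset2_subset Pset2_nonempty[OF ext i] _ v0 v1
  proof (rule family_bound)
    show "family UNIV it"
      unfolding family_def
    proof (intro ballI impI, rule ccontr)
      fix s s' w w'
      assume *: "s \<noteq> s'" "w \<in> words (it s)" "w' \<in> words (it s')" "\<not> w \<parallel> w'"
      obtain u where u: "prefix w u" "prefix w' u"
        "length (fc F i s) + 2 + (length (fc F i s') + 2) \<le> length u"
        using comparable_extension[OF *(4)] by blast
      obtain a where "a \<in> ?A s" "prefix (fc F i s @ a) u"
        using long[OF *(2) u(1)] u(3) by auto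
      moreover obtain a' where "a' \<in> ?A s'" "prefix (fc F i s' @ a') u"
        using long[OF *(3) u(2)] u(3) by auto
      ultimately show False using decodable_incomparable[OF dec i *(1)] by blast
    qed
    \<comment> \<open>If a word met \<open>d\<close>, some source sequence starting with
      \<open>s\<close> would emit \<open>d\<close>, so \<open>d\<close> would belong to the set of
      first pairs.\<close>
    show "w \<parallel> d" if w: "w \<in> words (it s)" and d: "d \<in> bits2 - Pset F 2 i []" for s w d
    proof (rule ccontr)
      assume "\<not> w \<parallel> d"
      then obtain u where u: "prefix w u" "prefix d u" "length (fc F i s) + 2 \<le> length u"
        using comparable_extension by blast
      obtain a where a: "a \<in> ?A s" "prefix (fc F i s @ a) u"
        using long[OF w u(1,3)] by blast
      have "prefix d (fc F i s @ a)"
        using a d u by (intro prefix_length_prefix[OF u(2) a(2)]) (auto simp: Pset_def bits2_def)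
      moreover obtain x where "x \<noteq> []" "prefix (fc F i s @ a) (fstar F i x)"
        using Pset_Cons[OF a(1)] .
      ultimately have "d \<in> Pset F 2 i []"
        unfolding Pset_def using d prefix_order.trans by (auto simp: bits2_def)
      then show False using d by blast
    qed
  qed
  then show ?thesis by (simp add: family_cost_def cost)
qed

section \<open>Stationary distributions\<close>

lemma sum_Qmat:
  fixes F :: "'s code_tuple"
  assumes "finite (UNIV :: 's set)" "wf_ct F" "i < ntab F"
  shows "(\<Sum>j<ntab F. Qmat \<mu> F i j * \<phi> j) = (\<Sum>s\<in>UNIV. \<mu> s * \<phi> (tc F i s))"
proof -
  have "(\<Sum>j<ntab F. Qmat \<mu> F i j * \<phi> j) = (\<Sum>j<ntab F. \<Sum>s | s \<in> UNIV \<and> tc F i s = j. \<mu> s * \<phi> (tc F i s))"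
    by (auto simp: Qmat_def sum_distrib_right intro!: sum.cong)
  also have "\<dots> = (\<Sum>s\<in>UNIV. \<mu> s * \<phi> (tc F i s))"
    using assms by (intro sum.group) (auto simp: wf_ct_def)
  finally show ?thesis .
qed

text \<open>Invariance of \<open>\<pi>\<close>: the mean of \<open>\<phi>\<close> after one step
  equals its mean before.\<close>

lemma stationary_potential:
  fixes F :: "'s code_tuple"
  assumes "finite (UNIV :: 's set)" "wf_ct F" "stationary \<mu> F \<pi>"
  shows "(\<Sum>i<ntab F. \<pi> i * Li \<mu> F i) = (\<Sum>i<ntab F. \<pi> i *
    ((\<Sum>s\<in>UNIV. \<mu> s * (real (length (fc F i s)) + \<phi> (tc F i s))) - \<phi> i))"
proof -
  have "(\<Sum>i<ntab F. \<pi> i * (\<Sum>s\<in>UNIV. \<mu> s * \<phi> (tc F i s)))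
      = (\<Sum>i<ntab F. \<pi> i * (\<Sum>j<ntab F. Qmat \<mu> F i j * \<phi> j))"
    using sum_Qmat[OF assms(1,2)] by (intro sum.cong) auto
  also have "\<dots> = (\<Sum>j<ntab F. (\<Sum>i<ntab F. \<pi> i * Qmat \<mu> F i j) * \<phi> j)"
    by (simp add: sum_distrib_left sum_distrib_right mult.assoc) (rule sum.swap)
  also have "\<dots> = (\<Sum>j<ntab F. \<pi> j * \<phi> j)"
    using assms(3) by (intro sum.cong) (auto simp: stationary_def)
  finally show ?thesis
    by (simp add: Li_def distrib_left right_diff_distrib sum.distrib sum_subtractf mult.commute)
qed

lemma stationary_pi_ct: "F \<in> F_reg \<mu> \<Longrightarrow> stationary \<mu> F (pi_ct \<mu> F)"
  unfolding F_reg_def pi_ct_def by (blast intro: theI'[of "stationary \<mu> F"])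

text \<open>If \<open>\<pi>\<close> is stationary, so is \<open>\<bar>\<pi>\<bar>\<close> up to normalisation; by uniqueness \<open>\<pi>\<close> is nonnegative.\<close>
lemma pi_ct_nonneg:
  fixes F :: "'s code_tuple"
  assumes fin: "finite (UNIV :: 's set)" and \<mu>: "\<And>s. 0 \<le> \<mu> s" "sum \<mu> UNIV = 1"
    and F: "F \<in> F_reg \<mu>"
  shows "0 \<le> pi_ct \<mu> F i"
proof -
  let ?m = "ntab F"
  define \<pi> where "\<pi> = pi_ct \<mu> F"
  have st: "stationary \<mu> F \<pi>" using stationary_pi_ct[OF F] by (simp add: \<pi>_def)
  have wf: "wf_ct F" using F by (simp add: F_reg_def)
  have Q: "0 \<le> Qmat \<mu> F i j" for i j by (simp add: Qmat_def sum_nonneg \<mu>)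
  have row: "(\<Sum>j<?m. Qmat \<mu> F i j) = 1" if "i < ?m" for i
    using sum_Qmat[OF fin wf that, of \<mu> "\<lambda>_. 1"] \<mu> by simp
  define N where "N = (\<Sum>i<?m. \<bar>\<pi> i\<bar>)"
  have "sum \<pi> {..<?m} = 1" using st by (simp add: stationary_def)
  then have "1 \<le> N" using sum_abs[of \<pi> "{..<?m}"] by (simp only: N_def)
  have le: "\<bar>\<pi> j\<bar> \<le> (\<Sum>i<?m. \<bar>\<pi> i\<bar> * Qmat \<mu> F i j)" if "j < ?m" for j
  proof -
    have "\<bar>\<pi> j\<bar> = \<bar>\<Sum>i<?m. \<pi> i * Qmat \<mu> F i j\<bar>" using st that by (simp add: stationary_def)
    also have "\<dots> \<le> (\<Sum>i<?m. \<bar>\<pi> i * Qmat \<mu> F i j\<bar>)" by (rule sum_abs)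
    finally show ?thesis using Q by (simp add: abs_mult)
  qed
  have "(\<Sum>j<?m. \<Sum>i<?m. \<bar>\<pi> i\<bar> * Qmat \<mu> F i j) = (\<Sum>i<?m. \<bar>\<pi> i\<bar> * (\<Sum>j<?m. Qmat \<mu> F i j))"
    by (subst sum.swap) (simp add: sum_distrib_left)
  also have "\<dots> = N" using row by (simp add: N_def)
  \<comment> \<open>Both sides of \<open>le\<close> have the same total, since the rows of the
    transition matrix sum to 1; hence every instance of \<open>le\<close> is an equality.\<close>
  finally have "(\<Sum>j<?m. (\<Sum>i<?m. \<bar>\<pi> i\<bar> * Qmat \<mu> F i j) - \<bar>\<pi> j\<bar>) = 0"
    by (simp add: sum_subtractf N_def)
  then have eq: "(\<Sum>i<?m. \<bar>\<pi> i\<bar> * Qmat \<mu> F i j) = \<bar>\<pi> j\<bar>" if "j < ?m" for j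
    using le that by (subst (asm) sum_nonneg_eq_0_iff) auto
  have "stationary \<mu> F (\<lambda>i. \<bar>\<pi> i\<bar> / N)"
    unfolding stationary_def
  proof (intro conjI allI impI)
    show "\<bar>\<pi> j\<bar> / N = 0" if "?m \<le> j" for j using st that by (simp add: stationary_def)
    show "(\<Sum>i<?m. \<bar>\<pi> i\<bar> / N * Qmat \<mu> F i j) = \<bar>\<pi> j\<bar> / N" if "j < ?m" for j
      using eq[OF that] by (simp add: sum_divide_distrib[symmetric])
    show "(\<Sum>i<?m. \<bar>\<pi> i\<bar> / N) = 1"
      using \<open>1 \<le> N\<close> by (simp add: sum_divide_distrib[symmetric] flip: N_def)
  qed
  then have "\<pi> = (\<lambda>i. \<bar>\<pi> i\<bar> / N)" using F st by (auto simp: F_reg_def)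
  then have "\<pi> i = \<bar>\<pi> i\<bar> / N" by (rule fun_cong)
  then show ?thesis using \<open>1 \<le> N\<close> by (simp add: \<pi>_def[symmetric]) (metis abs_ge_zero divide_nonneg_nonneg order.trans zero_le_one)
qed

section \<open>Code-tuples from trees\<close>

text \<open>A proper extension of \<open>b\<close> has at least one more bit, so the bit after
  \<open>b\<close> is already decided by the first codeword.\<close>

lemma Pbar1_iff: "[c] \<in> Pbar F 1 i b \<longleftrightarrow> (\<exists>s. prefix (b @ [c]) (fc F i s))"
proof
  assume "[c] \<in> Pbar F 1 i b"
  then obtain x where x: "x \<noteq> []" "prefix (b @ [c]) (fstar F i x)" "strict_prefix b (fc F i (hd x))"
    by (auto simp: Pbar_def)
  obtain d r where "fc F i (hd x) = b @ d # r" using x(3) by (rule strict_prefixE')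
  moreover have "fstar F i x = fc F i (hd x) @ fstar F (tc F i (hd x)) (tl x)"
    using x(1) by (cases x) auto
  ultimately have "prefix (b @ [c]) (fc F i (hd x))" using x(2) by simp
  then show "\<exists>s. prefix (b @ [c]) (fc F i s)" by blast
next
  assume "\<exists>s. prefix (b @ [c]) (fc F i s)"
  then obtain s where "prefix (b @ [c]) (fc F i s)" by blast
  then show "[c] \<in> Pbar F 1 i b"
    unfolding Pbar_def by (auto intro!: exI[of _ "[s]"] simp: prefix_def strict_prefix_def)
qed

lemma Pbar0_empty_iff: "Pbar F 0 i b = {} \<longleftrightarrow> (\<forall>s. \<not> strict_prefix b (fc F i s))"
proof -
  have "[] \<in> Pbar F 0 i b" if "strict_prefix b (fc F i s)" for s
    unfolding Pbar_def using that by (auto intro!: exI[of _ "[s]"] simp: strict_prefix_def)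
  then show ?thesis by (auto simp: Pbar_def)
qed

lemma card_Pbar1:
  assumes "card (Pbar F 1 i b) = 1"
  obtains c where "[c] \<in> Pbar F 1 i b" "[\<not> c] \<notin> Pbar F 1 i b"
proof -
  obtain w where w: "Pbar F 1 i b = {w}" using assms by (auto simp: card_1_singleton_iff)
  then have "length w = 1" by (auto simp: Pbar_def)
  then obtain c where "w = [c]" by (auto simp: length_Suc_conv)
  then show ?thesis using that[of c] w by auto
qed

text \<open>Conditions (i) to (iii) of AIFV codes, read through \<open>Pbar1_iff\<close> and
  restricted to a set \<open>X\<close> so that they can be proved by induction on trees.\<close>

definition aifv_enc :: "('s \<Rightarrow> bool list) \<Rightarrow> 's set \<Rightarrow> bool" where
  "aifv_enc e X \<longleftrightarrow> inj_on e X \<and> (\<forall>s\<in>X. \<forall>s'\<in>X. \<not> prefix (e s @ [True]) (e s') \<and>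
     \<not> prefix (e s @ [False, True]) (e s') \<and> e s' \<noteq> e s @ [False])"

lemma aifv_enc_Cons: "aifv_enc e X \<Longrightarrow> aifv_enc (\<lambda>s. c # e s) X"
  by (auto simp: aifv_enc_def inj_on_def)

lemma aifv_enc_join:
  "\<lbrakk>aifv_enc e Y; aifv_enc e' Z; Y \<inter> Z = {}\<rbrakk>
    \<Longrightarrow> aifv_enc (\<lambda>s. if s \<in> Y then False # e s else True # e' s) (Y \<union> Z)"
  by (auto simp: aifv_enc_def inj_on_def)

lemma aifv_enc_cong: "(\<And>s. s \<in> X \<Longrightarrow> e s = e' s) \<Longrightarrow> aifv_enc e X = aifv_enc e' X"
  by (simp add: aifv_enc_def cong: inj_on_cong)

lemma aifv_enc_tree: "good t \<Longrightarrow> aifv_enc (enc t) (syms t)"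
proof (induction t)
  case (Leaf a)
  then show ?case by (simp add: aifv_enc_def)
next
  case (Part a t)
  then have t: "aifv_enc (\<lambda>s. False # False # enc t s) (syms t)" and a: "a \<notin> syms t"
    by (auto intro: aifv_enc_Cons)
  have "aifv_enc (enc (Part a t)) (syms t)"
    by (rule aifv_enc_cong[THEN iffD1, OF _ t]) (use a in auto)
  then show ?case using a by (auto simp: aifv_enc_def inj_on_def)
next
  case (Node t u)
  then have "aifv_enc (\<lambda>s. if s \<in> syms t then False # enc t s else True # enc u s) (syms t \<union> syms u)"
    by (intro aifv_enc_join) auto
  then show ?case by simp
qed

lemma aifv_enc_pair:
  assumes "good (Node t u)"
  shows "aifv_enc (enc1 (t, u)) (syms t \<union> syms u)"
proof -
  have "aifv_enc (\<lambda>s. if s \<in> syms t then False # True # enc t s else True # enc u s) (syms t \<union> syms u)"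
    using assms by (intro aifv_enc_join aifv_enc_Cons aifv_enc_tree) auto
  then show ?thesis by (simp only: enc1_def[abs_def] fst_conv snd_conv)
qed

text \<open>The disjunction that condition (vii) of AIFV codes demands of a node \<open>b\<close> having the child \<open>b @ [c]\<close>.\<close>
definition branches :: "('s \<Rightarrow> bool list) \<Rightarrow> 's set \<Rightarrow> bool list \<Rightarrow> bool \<Rightarrow> bool" where
  "branches e X b c \<longleftrightarrow> (\<exists>s\<in>X. prefix (b @ [\<not> c]) (e s)) \<or>
     (\<exists>s\<in>X. \<exists>d. length d \<le> 1 \<and> e s @ d = b)"

lemma branches_append:
  assumes "branches e X b c" "X \<subseteq> Y" "\<And>s. s \<in> X \<Longrightarrow> e' s = p @ e s"
  shows "branches e' Y (p @ b) c"
  using assms(1) unfolding branches_def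
proof (elim disjE bexE exE conjE)
  fix s assume "s \<in> X" "prefix (b @ [\<not> c]) (e s)"
  then have "s \<in> Y" "prefix ((p @ b) @ [\<not> c]) (e' s)" using assms by auto
  then show "(\<exists>s\<in>Y. prefix ((p @ b) @ [\<not> c]) (e' s)) \<or> (\<exists>s\<in>Y. \<exists>d. length d \<le> 1 \<and> e' s @ d = p @ b)"
    by blast
next
  fix s d assume "s \<in> X" "length d \<le> 1" "e s @ d = b"
  then have "s \<in> Y" "length d \<le> 1" "e' s @ d = p @ b" using assms by auto
  then show "(\<exists>s\<in>Y. prefix ((p @ b) @ [\<not> c]) (e' s)) \<or> (\<exists>s\<in>Y. \<exists>d. length d \<le> 1 \<and> e' s @ d = p @ b)"
    by blast
qed

lemma branches_sibling: "s \<in> X \<Longrightarrow> prefix (b @ [\<not> c]) (e s) \<Longrightarrow> branches e X b c"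
  by (auto simp: branches_def)

lemma branches_after: "s \<in> X \<Longrightarrow> e s @ d = b \<Longrightarrow> length d \<le> 1 \<Longrightarrow> branches e X b c"
  by (auto simp: branches_def)

text \<open>Nodes with a single child arise only from \<open>Part\<close>: the node of the codeword,
  and its child 0 on the way to 00. Both are the codeword followed by at most one bit.\<close>

lemma enc_branches:
  assumes "good t" "s \<in> syms t" "prefix (b @ [c]) (enc t s)"
  shows "branches (enc t) (syms t) b c"
  using assms
proof (induction t arbitrary: b s)
  case (Leaf a)
  then show ?case by simp
next
  case (Part a t)
  then have s: "s \<in> syms t" "s \<noteq> a" "good t" "a \<notin> syms t" by (auto split: if_splits)
  then have pre: "prefix (b @ [c]) (False # False # enc t s)" using Part.prems by simp
  show ?case
  proof (cases b rule: remdups_adj.cases)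
    case 1
    then show ?thesis by (intro branches_after[of a _ _ "[]"]) auto
  next
    case (2 x)
    then show ?thesis using pre by (intro branches_after[of a _ _ "[False]"]) auto
  next
    case (3 x y b')
    then have b: "b = [False, False] @ b'" and "prefix (b' @ [c]) (enc t s)" using pre by auto
    from Part.IH[OF s(3,1) this(2)] show ?thesis
      unfolding b by (rule branches_append) (use s in auto)
  qed
next
  case (Node t u)
  have dis: "syms t \<inter> syms u = {}" and g: "good t" "good u" using Node.prems by auto
  obtain st su where st: "st \<in> syms t" and su: "su \<in> syms u"
    using syms_nonempty by (metis all_not_in_conv)
  have et: "enc (Node t u) r = [False] @ enc t r" if "r \<in> syms t" for r using that by simp
  have eu: "enc (Node t u) r = [True] @ enc u r" if "r \<in> syms u" for r using that dis by auto
  consider "s \<in> syms t" | "s \<in> syms u" using Node.prems by auto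
  then show ?case
  proof cases
    case 1
    show ?thesis
    proof (cases b)
      case Nil
      then have "\<not> c" using Node.prems(3) et[OF 1] by simp
      then show ?thesis using su Nil eu[OF su] by (intro branches_sibling[of su]) auto
    next
      case (Cons x b')
      then have b: "b = [False] @ b'" "prefix (b' @ [c]) (enc t s)" using Node.prems(3) et[OF 1] by auto
      from Node.IH(1)[OF g(1) 1 b(2)] show ?thesis
        unfolding b(1) by (rule branches_append) (use et in auto)
    qed
  next
    case 2
    show ?thesis
    proof (cases b)
      case Nil
      then have "c" using Node.prems(3) eu[OF 2] by simp
      then show ?thesis using st Nil et[OF st] by (intro branches_sibling[of st]) auto
    next
      case (Cons x b')
      then have b: "b = [True] @ b'" "prefix (b' @ [c]) (enc u s)" using Node.prems(3) eu[OF 2] by auto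
      from Node.IH(2)[OF g(2) 2 b(2)] show ?thesis
        unfolding b(1) by (rule branches_append) (use eu dis in auto)
    qed
  qed
qed

text \<open>The trees hang below 01 and 1, so the node 0 has the single child 01. This is the
  exception that condition (vii) grants to table 1.\<close>

lemma enc1_branches:
  assumes g: "good (Node t u)" and s: "s \<in> syms t \<union> syms u" and pre: "prefix (b @ [c]) (enc1 (t, u) s)"
    and b: "b \<noteq> [False]"
  shows "branches (enc1 (t, u)) (syms t \<union> syms u) b c"
proof -
  have dis: "syms t \<inter> syms u = {}" and g: "good t" "good u" using g by auto
  obtain st su where st: "st \<in> syms t" and su: "su \<in> syms u"
    using syms_nonempty by (metis all_not_in_conv)
  have et: "enc1 (t, u) r = [False, True] @ enc t r" if "r \<in> syms t" for r
    using that by (simp add: enc1_def)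
  have eu: "enc1 (t, u) r = [True] @ enc u r" if "r \<in> syms u" for r
    using that dis by (auto simp: enc1_def)
  consider "s \<in> syms t" | "s \<in> syms u" using s by auto
  then show ?thesis
  proof cases
    case 1
    show ?thesis
    proof (cases b rule: remdups_adj.cases)
      case b: 1
      then have "\<not> c" using pre et[OF 1] by simp
      then show ?thesis using su b eu[OF su] by (intro branches_sibling[of su]) auto
    next
      case (2 x)
      then show ?thesis using pre et[OF 1] b by simp
    next
      case (3 x y b')
      then have b: "b = [False, True] @ b'" "prefix (b' @ [c]) (enc t s)" using pre et[OF 1] by auto
      from enc_branches[OF g(1) 1 b(2)] show ?thesis
        unfolding b(1) by (rule branches_append) (use et in auto)
    qed
  next
    case 2
    show ?thesis
    proof (cases b)
      case Nil
      then have "c" using pre eu[OF 2] by simp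
      then show ?thesis using st Nil et[OF st] by (intro branches_sibling[of st]) auto
    next
      case (Cons x b')
      then have b: "b = [True] @ b'" "prefix (b' @ [c]) (enc u s)" using pre eu[OF 2] by auto
      from enc_branches[OF g(2) 2 b(2)] show ?thesis
        unfolding b(1) by (rule branches_append) (use eu in auto)
    qed
  qed
qed

text \<open>This matches the switching rule to condition (iv): the tree below a \<open>Part\<close>
  is never empty, so the codeword of its symbol always has a proper extension, while that of a leaf
  has none.\<close>

lemma partials_iff:
  assumes "good t" "s \<in> syms t"
  shows "s \<in> partials t \<longleftrightarrow> (\<exists>s'\<in>syms t. strict_prefix (enc t s) (enc t s'))"
  using assms
proof (induction t)
  case (Leaf a)
  then show ?case by simp
next
  case (Part a t)
  obtain r where r: "r \<in> syms t" using syms_nonempty[of t] by blast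
  have e: "enc (Part a t) x = False # False # enc t x" if "x \<in> syms t" for x
    using that Part.prems by auto
  show ?case
  proof (cases "s = a")
    case True
    have "strict_prefix (enc (Part a t) a) (enc (Part a t) r)" using e[OF r] by simp
    then show ?thesis using True r Part.prems by auto
  next
    case False
    then have s: "s \<in> syms t" using Part.prems by simp
    have "strict_prefix (enc (Part a t) s) (enc (Part a t) s') \<longleftrightarrow> strict_prefix (enc t s) (enc t s')"
      if "s' \<in> syms t" for s'
      unfolding e[OF s] e[OF that] by simp
    moreover have "\<not> strict_prefix (enc (Part a t) s) (enc (Part a t) a)"
      by simp
    ultimately have "(\<exists>s'\<in>syms (Part a t). strict_prefix (enc (Part a t) s) (enc (Part a t) s'))
      \<longleftrightarrow> (\<exists>s'\<in>syms t. strict_prefix (enc t s) (enc t s'))"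
      unfolding aifv_tree.set by blast
    then show ?thesis using Part s False by simp
  qed
next
  case (Node t u)
  have sub: "partials t \<subseteq> syms t" "partials u \<subseteq> syms u"
    using Node.prems partials_psubset[of t] partials_psubset[of u] by auto
  then show ?case using Node by (auto 0 3)
qed

lemma pair_partials_iff:
  assumes "good (Node t u)" "s \<in> syms t \<union> syms u"
  shows "s \<in> partials t \<union> partials u \<longleftrightarrow>
    (\<exists>s'\<in>syms t \<union> syms u. strict_prefix (enc1 (t, u) s) (enc1 (t, u) s'))"
proof -
  have sub: "partials t \<subseteq> syms t" "partials u \<subseteq> syms u"
    using assms partials_psubset[of t] partials_psubset[of u] by auto
  then show ?thesis using assms partials_iff[of t s] partials_iff[of u s] by (auto 0 3 simp: enc1_def)
qed

definition aifv_code :: "'s aifv_tree \<Rightarrow> 's aifv_tree \<times> 's aifv_tree \<Rightarrow> 's code_tuple" where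
  "aifv_code t p = \<lparr>ntab = 2,
     fc = (\<lambda>i. if i = 0 then enc t else enc1 p),
     tc = (\<lambda>i s. if s \<in> (if i = 0 then partials t else partials (fst p) \<union> partials (snd p)) then 1 else 0)\<rparr>"

lemma aifv_code_in_AIFV:
  assumes "t \<in> trees_on UNIV" "p \<in> pairs_on UNIV"
  shows "aifv_code t p \<in> F_AIFV"
proof -
  let ?F = "aifv_code t p"
  obtain u v where p: "p = (u, v)" by (cases p)
  have g: "good t" "good (Node u v)" and UNIV: "syms t = UNIV" "syms u \<union> syms v = UNIV"
    using assms by (auto simp: p trees_on_def pairs_on_def)
  have fc: "fc ?F 0 = enc t" "fc ?F 1 = enc1 (u, v)" by (simp_all add: aifv_code_def p)
  have enc: "aifv_enc (fc ?F i) UNIV" if "i < 2" for i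
    using that aifv_enc_tree[OF g(1)] aifv_enc_pair[OF g(2)] unfolding UNIV
    by (auto simp: less_2_cases_iff fc simp flip: One_nat_def)
  have tc: "tc ?F i s = (if Pbar ?F 0 i (fc ?F i s) = {} then 0 else 1)" if "i < 2" for i s
    using that partials_iff[OF g(1), of s] pair_partials_iff[OF g(2), of s] unfolding UNIV Pbar0_empty_iff
    by (auto simp: less_2_cases_iff aifv_code_def p)
  have br: "branches (fc ?F i) UNIV b c"
    if i: "i < 2" "[c] \<in> Pbar ?F 1 i b" "\<not> (i = 1 \<and> b = [False])" for i b c
  proof -
    obtain s where s: "prefix (b @ [c]) (fc ?F i s)" using i(2) unfolding Pbar1_iff by blast
    consider "i = 0" | "i = 1" "b \<noteq> [False]" using i(1,3) by linarith
    then show ?thesis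
    proof cases
      case 1
      then show ?thesis using enc_branches[OF g(1), of s b c] s by (simp add: fc UNIV)
    next
      case 2
      then show ?thesis using enc1_branches[OF g(2), of s b c] s by (simp add: fc[unfolded One_nat_def] UNIV)
    qed
  qed
  show ?thesis
    unfolding F_AIFV_def
  proof (intro CollectI conjI allI impI)
    show "ntab ?F = 2" by (simp add: aifv_code_def)
    fix i :: nat and s s' b
    show "inj (fc ?F i)" "[True] \<notin> Pbar ?F 1 i (fc ?F i s)" "fc ?F i s' \<noteq> fc ?F i s @ [False]"
      "[True] \<notin> Pbar ?F 1 i (fc ?F i s @ [False])"
      if "i < 2" using enc[OF that] unfolding Pbar1_iff aifv_enc_def by auto
    show "tc ?F i s = (if Pbar ?F 0 i (fc ?F i s) = {} then 0 else 1)" if "i < 2" using tc[OF that] .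
    show "(\<exists>s c. length c \<le> 1 \<and> fc ?F i s @ c = b) \<or> (i = 1 \<and> b = [False])"
      if "i < 2" "card (Pbar ?F 1 i b) = 1"
    proof (rule card_Pbar1[OF that(2)])
      fix c assume c: "[c] \<in> Pbar ?F 1 i b" "[\<not> c] \<notin> Pbar ?F 1 i b"
      then show ?thesis using br[OF that(1) c(1)] c(2) unfolding Pbar1_iff branches_def by blast
    qed
  next
    show "fc ?F 1 s \<noteq> []" "fc ?F 1 s \<noteq> [False]" for s
      by (simp_all only: fc) (auto simp: enc1_def)
    show "[False] \<notin> Pbar ?F 1 1 [False]"
      unfolding Pbar1_iff fc by (auto simp: enc1_def split: if_splits)
  qed
qed

section \<open>AIFV code-tuples are extendable, decodable and regular\<close>

lemma AIFV_wf: "F \<in> F_AIFV \<Longrightarrow> wf_ct F"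
  by (simp add: F_AIFV_def wf_ct_def)

lemma AIFV_ext:
  fixes F :: "'s code_tuple"
  assumes "F \<in> F_AIFV" "2 \<le> card (UNIV :: 's set)"
  shows "F \<in> F_ext"
proof -
  have "Pset F 1 i [] \<noteq> {}" if i: "i < 2" for i
  proof -
    have "inj (fc F i)" using assms i by (simp add: F_AIFV_def)
    moreover have "\<not> card (UNIV :: 's set) \<le> Suc 0" using assms(2) by simp
    then obtain a b :: 's where "a \<noteq> b"
      by (metis (full_types) card_le_Suc0_iff_eq card.infinite le0)
    ultimately obtain s where "fc F i s \<noteq> []" by (metis injD)
    then have "[hd (fc F i s)] \<in> Pset F 1 i []"
      by (cases "fc F i s") (auto simp: Pset_def intro!: exI[of _ "[s]"])
    then show ?thesis by blast
  qed
  then show ?thesis using AIFV_wf[OF assms(1)] assms(1) by (simp add: F_ext_def F_AIFV_def)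
qed

text \<open>Table 1 never starts with 00, and a proper extension of a codeword always continues with 00.\<close>
lemma AIFV_decodable:
  assumes F: "F \<in> F_AIFV"
  shows "k_bit_delay_decodable 2 F"
proof -
  have n: "ntab F = 2" and inj: "\<And>i. i < 2 \<Longrightarrow> inj (fc F i)"
    and ii: "\<And>i s. i < 2 \<Longrightarrow> [True] \<notin> Pbar F 1 i (fc F i s)"
      "\<And>i s. i < 2 \<Longrightarrow> [True] \<notin> Pbar F 1 i (fc F i s @ [False])"
    and iii: "\<And>i s s'. i < 2 \<Longrightarrow> fc F i s' \<noteq> fc F i s @ [False]"
    and iv: "\<And>i s. i < 2 \<Longrightarrow> tc F i s = (if Pbar F 0 i (fc F i s) = {} then 0 else 1)"
    and v: "\<And>s. fc F 1 s \<noteq> []" "\<And>s. fc F 1 s \<noteq> [False]" and vi: "[False] \<notin> Pbar F 1 1 [False]"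
    using F by (auto simp: F_AIFV_def)
  have one: "[False, False] \<notin> Pset F 2 1 []"
  proof
    assume "[False, False] \<in> Pset F 2 1 []"
    then obtain x where x: "x \<noteq> []" "prefix [False, False] (fstar F 1 x)" by (auto simp: Pset_def)
    then obtain r where "prefix [False, False] (fc F 1 (hd x) @ r)" by (cases x) auto
    then have "prefix [False, False] (fc F 1 (hd x))"
      using v[of "hd x"] by (cases "fc F 1 (hd x)" rule: remdups_adj.cases) auto
    then show False using vi unfolding Pbar1_iff by auto
  qed
  have ext: "c = [False, False] \<and> tc F i s = 1" if i: "i < 2" and c: "c \<in> Pbar F 2 i (fc F i s)" for i s c
  proof -
    obtain x where x: "x \<noteq> []" "prefix (fc F i s @ c) (fstar F i x)" "strict_prefix (fc F i s) (fc F i (hd x))"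
      and len: "length c = 2"
      using c by (auto simp: Pbar_def)
    obtain d r where dr: "fc F i (hd x) = fc F i s @ d # r" using x(3) by (rule strict_prefixE')
    then have "prefix (fc F i s @ [d]) (fc F i (hd x))" by simp
    then have d: "d = False" using ii(1)[OF i, of s] unfolding Pbar1_iff by (metis (full_types))
    then have "r \<noteq> []" using iii[OF i, of "hd x" s] dr by auto
    then obtain e r' where r: "r = e # r'" by (cases r) auto
    then have "prefix ((fc F i s @ [False]) @ [e]) (fc F i (hd x))" using dr d by simp
    then have e: "e = False" using ii(2)[OF i, of s] unfolding Pbar1_iff by (metis (full_types))
    have "prefix (fc F i (hd x)) (fstar F i x)" using x(1) by (cases x) auto
    then have "prefix (fc F i s @ [False, False]) (fstar F i x)"
      using dr d r e by (auto simp: prefix_def)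
    then have "c = [False, False]"
      using x(2) len by (cases c rule: remdups_adj.cases) (auto simp: prefix_def)
    moreover have "tc F i s = 1" using x(3) iv[OF i, of s] Pbar0_empty_iff[of F i "fc F i s"] by auto
    ultimately show ?thesis by blast
  qed
  have "Pset F 2 (tc F i s) [] \<inter> Pbar F 2 i (fc F i s) = {}" if "i < 2" for i s
  proof (rule equals0I)
    fix c assume c: "c \<in> Pset F 2 (tc F i s) [] \<inter> Pbar F 2 i (fc F i s)"
    then have "c = [False, False]" "tc F i s = 1" using ext[OF that, of c s] by auto
    then show False using c one by simp
  qed
  then show ?thesis
    unfolding k_bit_delay_decodable_def n using inj by (blast dest: injD)
qed

text \<open>A longest codeword of table 1 has no proper extension, so its symbol returns to table 0
  with positive probability. Hence the two states cannot both be absorbing.\<close>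

lemma AIFV_regular:
  fixes F :: "'s code_tuple"
  assumes F: "F \<in> F_AIFV" and fin: "finite (UNIV :: 's set)"
    and \<mu>: "\<And>s. 0 < \<mu> s" "sum \<mu> UNIV = 1"
  shows "F \<in> F_reg \<mu>"
proof -
  have n: "ntab F = 2" using F by (simp add: F_AIFV_def)
  have wf: "wf_ct F" using AIFV_wf[OF F] .
  define q\<^sub>0 where "q\<^sub>0 = Qmat \<mu> F 0 1"
  define q\<^sub>1 where "q\<^sub>1 = Qmat \<mu> F 1 1"
  have row: "Qmat \<mu> F i 0 + Qmat \<mu> F i 1 = 1" if "i < 2" for i
    using sum_Qmat[OF fin wf, of i \<mu> "\<lambda>_. 1"] that \<mu>(2) by (simp add: n numeral_2_eq_2)
  have Q: "Qmat \<mu> F 0 0 = 1 - q\<^sub>0" "Qmat \<mu> F 0 1 = q\<^sub>0" "Qmat \<mu> F 1 0 = 1 - q\<^sub>1" "Qmat \<mu> F 1 1 = q\<^sub>1"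
    using row[of 0] row[of 1] by (simp_all add: q\<^sub>0_def q\<^sub>1_def)
  have "0 \<le> q\<^sub>0" using less_imp_le[OF \<mu>(1)] by (simp add: q\<^sub>0_def Qmat_def sum_nonneg)
  have "finite (range (\<lambda>s. length (fc F 1 s)))" using fin by simp
  then obtain s where s: "\<And>s'. length (fc F 1 s') \<le> length (fc F 1 s)"
    using Max_ge Max_in by (smt (verit) UNIV_not_empty empty_is_image imageE rangeI)
  have "\<not> strict_prefix (fc F 1 s) (fc F 1 s')" for s'
    using s[of s'] prefix_length_less[of "fc F 1 s" "fc F 1 s'"] by linarith
  then have "Pbar F 0 1 (fc F 1 s) = {}" unfolding Pbar0_empty_iff by blast
  then have "tc F 1 s = 0" using F by (simp add: F_AIFV_def)
  then have "\<mu> s \<le> Qmat \<mu> F 1 0"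
    unfolding Qmat_def using fin \<mu>(1) by (intro member_le_sum) (auto intro: less_imp_le finite_subset)
  then have "q\<^sub>1 < 1" using \<mu>(1)[of s] Q by simp
  \<comment> \<open>Stationary weights are in the ratio \<open>1 - q\<^sub>1\<close> to
    \<open>q\<^sub>0\<close>; \<open>D\<close> normalises them.\<close>
  define D where "D = 1 - q\<^sub>1 + q\<^sub>0"
  have D: "D > 0" using \<open>0 \<le> q\<^sub>0\<close> \<open>q\<^sub>1 < 1\<close> by (simp add: D_def)
  have iff: "stationary \<mu> F \<pi> \<longleftrightarrow> (\<forall>j\<ge>2. \<pi> j = 0) \<and> \<pi> 0 = (1 - q\<^sub>1) / D \<and> \<pi> 1 = q\<^sub>0 / D" for \<pi>
  proof -
    have "stationary \<mu> F \<pi> \<longleftrightarrow> (\<forall>j\<ge>2. \<pi> j = 0) \<and> (\<pi> 0 * (1 - q\<^sub>0) + \<pi> 1 * (1 - q\<^sub>1) = \<pi> 0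
        \<and> \<pi> 0 * q\<^sub>0 + \<pi> 1 * q\<^sub>1 = \<pi> 1) \<and> \<pi> 0 + \<pi> 1 = 1"
      unfolding stationary_def n using Q
      by (simp add: numeral_2_eq_2 less_Suc_eq all_conj_distrib)
    also have "\<dots> \<longleftrightarrow> (\<forall>j\<ge>2. \<pi> j = 0) \<and> \<pi> 0 = (1 - q\<^sub>1) / D \<and> \<pi> 1 = q\<^sub>0 / D"
    proof -
      have "(\<pi> 0 * (1 - q\<^sub>0) + \<pi> 1 * (1 - q\<^sub>1) = \<pi> 0 \<and> \<pi> 0 * q\<^sub>0 + \<pi> 1 * q\<^sub>1 = \<pi> 1) \<and> \<pi> 0 + \<pi> 1 = 1
        \<longleftrightarrow> \<pi> 0 * D = 1 - q\<^sub>1 \<and> \<pi> 1 * D = q\<^sub>0" (is "?l \<longleftrightarrow> ?r")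
      proof
        assume ?l
        then have e: "\<pi> 0 = 1 - \<pi> 1" "\<pi> 0 * q\<^sub>0 + \<pi> 1 * q\<^sub>1 = \<pi> 1" by auto
        have "\<pi> 1 * D = q\<^sub>0" using e(2) unfolding e(1) by (simp add: D_def algebra_simps)
        moreover have "\<pi> 0 * D = D - \<pi> 1 * D" unfolding e(1) by (simp add: left_diff_distrib)
        moreover have "D - q\<^sub>0 = 1 - q\<^sub>1" by (simp add: D_def)
        ultimately show ?r by simp
      next
        assume r: ?r
        then have "(\<pi> 0 + \<pi> 1) * D = 1 * D" by (simp add: D_def algebra_simps)
        then have e: "\<pi> 0 = 1 - \<pi> 1" using D by simp
        have "\<pi> 1 * (1 - q\<^sub>1 + q\<^sub>0) = q\<^sub>0" using r by (simp add: D_def)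
        then show ?l unfolding e by (simp add: algebra_simps)
      qed
      then show ?thesis using D by (simp add: field_simps)
    qed
    finally show ?thesis .
  qed
  have "\<exists>!\<pi>. stationary \<mu> F \<pi>"
  proof (rule ex1I[of _ "\<lambda>j. if j = 0 then (1 - q\<^sub>1) / D else if j = 1 then q\<^sub>0 / D else 0"])
    fix \<pi> assume "stationary \<mu> F \<pi>"
    then have "\<forall>j\<ge>2. \<pi> j = 0" "\<pi> 0 = (1 - q\<^sub>1) / D" "\<pi> 1 = q\<^sub>0 / D" unfolding iff by auto
    then show "\<pi> = (\<lambda>j. if j = 0 then (1 - q\<^sub>1) / D else if j = 1 then q\<^sub>0 / D else 0)"
      by (intro ext) (auto simp: not_less_eq_eq numeral_2_eq_2)
  qed (simp add: iff)
  then show ?thesis using wf by (simp add: F_reg_def)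
qed

section \<open>Optimality\<close>

lemma sum_add_potential:
  fixes \<mu> :: "'s \<Rightarrow> real"
  assumes "finite (UNIV :: 's set)"
  shows "(\<Sum>s\<in>UNIV. \<mu> s * (l s + (if s \<in> P then h else 0))) = (\<Sum>s\<in>UNIV. \<mu> s * l s) + h * sum \<mu> P"
proof -
  have "(\<Sum>s\<in>UNIV. \<mu> s * (if s \<in> P then h else 0)) = (\<Sum>s\<in>P. h * \<mu> s)"
    using assms by (intro sum.mono_neutral_cong_right) auto
  then show ?thesis by (simp add: distrib_left sum.distrib sum_distrib_left)
qed

text \<open>With potential 0 for table 0 and \<open>h\<close> for table 1, both tables satisfy the
  optimality equation exactly, so averaging loses nothing.\<close>

lemma Lavg_aifv_code:
  fixes \<mu> :: "'s \<Rightarrow> real"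
  assumes fin: "finite (UNIV :: 's set)" and reg: "aifv_code t p \<in> F_reg \<mu>"
    and t: "t \<in> trees_on UNIV" "tree_cost \<mu> h t = v"
    and p: "p \<in> pairs_on UNIV" "pair_cost \<mu> h p = v + h"
  shows "Lavg \<mu> (aifv_code t p) = v"
proof -
  let ?F = "aifv_code t p" and ?\<pi> = "pi_ct \<mu> (aifv_code t p)"
  define \<phi> where "\<phi> j = (if j = (0::nat) then 0 else h)" for j
  have wf: "wf_ct ?F" using reg by (simp add: F_reg_def)
  have n: "ntab ?F = 2" by (simp add: aifv_code_def)
  obtain u w where uw: "p = (u, w)" by (cases p)
  have "(\<Sum>s\<in>UNIV. \<mu> s * (real (length (fc ?F i s)) + \<phi> (tc ?F i s))) - \<phi> i = v" if "i < 2" for i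
  proof (cases "i = 0")
    case True
    have "(\<Sum>s\<in>UNIV. \<mu> s * (real (length (fc ?F i s)) + \<phi> (tc ?F i s)))
      = (\<Sum>s\<in>UNIV. \<mu> s * (real (length (enc t s)) + (if s \<in> partials t then h else 0)))"
      by (intro sum.cong) (auto simp: True aifv_code_def \<phi>_def)
    then show ?thesis
      using t tree_cost_eq[of t \<mu> h] True by (simp add: sum_add_potential[OF fin] trees_on_def \<phi>_def)
  next
    case False
    have "(\<Sum>s\<in>UNIV. \<mu> s * (real (length (fc ?F i s)) + \<phi> (tc ?F i s)))
      = (\<Sum>s\<in>UNIV. \<mu> s * (real (length (enc1 p s)) + (if s \<in> partials u \<union> partials w then h else 0)))"
      using False by (intro sum.cong) (auto simp: uw aifv_code_def \<phi>_def)
    also have "\<dots> = pair_cost \<mu> h p"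
      unfolding sum_add_potential[OF fin] using p(1) pair_cost_eq[of u w \<mu> h]
      by (auto simp: uw pairs_on_def)
    finally show ?thesis using p(2) False by (simp add: \<phi>_def)
  qed
  then have "Lavg \<mu> ?F = (\<Sum>i<ntab ?F. ?\<pi> i * v)"
    unfolding Lavg_def stationary_potential[OF fin wf stationary_pi_ct[OF reg], of \<phi>]
    by (intro sum.cong) (auto simp: n)
  also have "\<dots> = v"
    using stationary_pi_ct[OF reg] by (simp add: sum_distrib_right[symmetric] stationary_def)
  finally show ?thesis .
qed

text \<open>Nonnegative stationary weights allow \<open>table_bound\<close> to be averaged over the
  tables.\<close>

lemma Lavg_lower_bound:
  fixes F :: "'s code_tuple"
  assumes fin: "finite (UNIV :: 's set)" and card: "2 \<le> card (UNIV :: 's set)"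
    and \<mu>: "\<And>s. 0 \<le> \<mu> s" "sum \<mu> UNIV = 1" and h: "0 \<le> h" and F: "F \<in> F_0 \<mu>"
    and v0: "\<And>t. t \<in> trees_on UNIV \<Longrightarrow> v \<le> tree_cost \<mu> h t"
    and v1: "\<And>p. p \<in> pairs_on UNIV \<Longrightarrow> v + h \<le> pair_cost \<mu> h p"
  shows "v \<le> Lavg \<mu> F"
proof -
  define \<phi> where "\<phi> j = pot h (Pset F 2 j [])" for j
  have reg: "F \<in> F_reg \<mu>" and ext: "F \<in> F_ext" and dec: "k_bit_delay_decodable 2 F" and wf: "wf_ct F"
    using F by (auto simp: F_0_def F_2dec_def)
  have "v = (\<Sum>i<ntab F. pi_ct \<mu> F i * v)"
    using stationary_pi_ct[OF reg] by (simp add: sum_distrib_right[symmetric] stationary_def)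
  also have "\<dots> \<le> (\<Sum>i<ntab F. pi_ct \<mu> F i *
    ((\<Sum>s\<in>UNIV. \<mu> s * (real (length (fc F i s)) + \<phi> (tc F i s))) - \<phi> i))"
  proof (intro sum_mono mult_left_mono)
    fix i assume "i \<in> {..<ntab F}"
    then have "v + \<phi> i \<le> (\<Sum>s\<in>UNIV. \<mu> s * (real (length (fc F i s)) + \<phi> (tc F i s)))"
      unfolding \<phi>_def using table_bound[of \<mu> h F i v] fin card \<mu> h ext dec v0 v1 by simp
    then show "v \<le> (\<Sum>s\<in>UNIV. \<mu> s * (real (length (fc F i s)) + \<phi> (tc F i s))) - \<phi> i" by simp
    show "0 \<le> pi_ct \<mu> F i" using pi_ct_nonneg[of \<mu> F i] fin \<mu> reg by simp
  qed
  also have "\<dots> = Lavg \<mu> F"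
    unfolding Lavg_def stationary_potential[OF fin wf stationary_pi_ct[OF reg], of \<phi>] ..
  finally show ?thesis .
qed

lemma continuous_on_Min_image:
  fixes f :: "'a \<Rightarrow> real \<Rightarrow> real"
  assumes "finite T" "T \<noteq> {}" "\<And>t. t \<in> T \<Longrightarrow> continuous_on S (f t)"
  shows "continuous_on S (\<lambda>h. Min ((\<lambda>t. f t h) ` T))"
  using assms
proof (induction T rule: finite_ne_induct)
  case (insert t T)
  then have "continuous_on S (\<lambda>h. min (f t h) (Min ((\<lambda>t. f t h) ` T)))"
    by (intro continuous_on_min) auto
  with insert show ?case by simp
qed simp

text \<open>At \<open>h = 0\<close> table 1 costs at least as much as table 0, at \<open>h = 1\<close> at most one bit more, and
  both minima depend continuously on \<open>h\<close>; so for some \<open>h\<close> the difference is exactly \<open>h\<close>.\<close>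
theorem balanced_potential:
  fixes \<mu> :: "'s \<Rightarrow> real"
  assumes fin: "finite X" and card: "2 \<le> card X" and \<mu>: "\<And>s. 0 \<le> \<mu> s" "sum \<mu> X = 1"
  obtains h v t p where "0 \<le> h" "t \<in> trees_on X" "tree_cost \<mu> h t = v"
    "p \<in> pairs_on X" "pair_cost \<mu> h p = v + h"
    "\<And>t. t \<in> trees_on X \<Longrightarrow> v \<le> tree_cost \<mu> h t"
    "\<And>p. p \<in> pairs_on X \<Longrightarrow> v + h \<le> pair_cost \<mu> h p"
proof -
  define V\<^sub>0 where "V\<^sub>0 h = Min ((\<lambda>t. tree_cost \<mu> h t) ` trees_on X)" for h
  define V\<^sub>1 where "V\<^sub>1 h = Min ((\<lambda>p. pair_cost \<mu> h p) ` pairs_on X)" for h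
  have finT: "finite (trees_on X)" "finite (pairs_on X)"
    using finite_trees_on[OF fin] finite_pairs_on[OF fin] .
  have neT: "trees_on X \<noteq> {}" using fin card by (intro trees_on_nonempty) auto
  then obtain t where "t \<in> trees_on X" by blast
  then have neP: "pairs_on X \<noteq> {}" using pair_of_tree[of t X \<mu> 0] card \<mu>(1) by auto
  have att0: "\<exists>t\<in>trees_on X. tree_cost \<mu> h t = V\<^sub>0 h" for h
  proof -
    have "V\<^sub>0 h \<in> (\<lambda>t. tree_cost \<mu> h t) ` trees_on X"
      unfolding V\<^sub>0_def using finT neT by (intro Min_in) auto
    then show ?thesis by auto
  qed
  have att1: "\<exists>p\<in>pairs_on X. pair_cost \<mu> h p = V\<^sub>1 h" for h
  proof -
    have "V\<^sub>1 h \<in> (\<lambda>p. pair_cost \<mu> h p) ` pairs_on X"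
      unfolding V\<^sub>1_def using finT neP by (intro Min_in) auto
    then show ?thesis by auto
  qed
  have le0: "V\<^sub>0 h \<le> tree_cost \<mu> h t" if "t \<in> trees_on X" for h t
    using that finT by (simp add: V\<^sub>0_def)
  have le1: "V\<^sub>1 h \<le> pair_cost \<mu> h p" if "p \<in> pairs_on X" for h p
    using that finT by (simp add: V\<^sub>1_def)
  \<comment> \<open>For a fixed tree the cost is affine in \<open>h\<close>.\<close>
  have cont_tree: "continuous_on {0..1} (\<lambda>h. tree_cost \<mu> h t)" for t
    by (induction t) (auto intro!: continuous_intros)
  have cont: "continuous_on {0..1} (\<lambda>h. V\<^sub>0 h + h - V\<^sub>1 h)"
    unfolding V\<^sub>0_def V\<^sub>1_def
    by (intro continuous_intros continuous_on_Min_image finT neT neP cont_tree)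
       (auto simp: pair_cost_def intro!: continuous_intros cont_tree)
  have lower: "V\<^sub>0 0 + 0 - V\<^sub>1 0 \<le> 0"
  proof -
    obtain p where p: "p \<in> pairs_on X" "pair_cost \<mu> 0 p = V\<^sub>1 0" using att1 by blast
    obtain t where "t \<in> trees_on X" "tree_cost \<mu> 0 t \<le> pair_cost \<mu> 0 p"
      using tree_of_pair[of p X \<mu> 0] p \<mu> by blast
    then show ?thesis using le0[of t 0] p by simp
  qed
  have upper: "0 \<le> V\<^sub>0 1 + 1 - V\<^sub>1 1"
  proof -
    obtain t where t: "t \<in> trees_on X" "tree_cost \<mu> 1 t = V\<^sub>0 1" using att0 by blast
    obtain p where "p \<in> pairs_on X" "pair_cost \<mu> 1 p \<le> tree_cost \<mu> 1 t + sum \<mu> X"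
      using pair_of_tree[of t X \<mu> 1] t card \<mu> by auto
    then show ?thesis using le1[of p 1] t \<mu> by simp
  qed
  obtain h where h: "0 \<le> h" "h \<le> 1" "V\<^sub>0 h + h - V\<^sub>1 h = 0"
    using IVT'[of "\<lambda>h. V\<^sub>0 h + h - V\<^sub>1 h" 0 0 1] lower upper cont by auto
  obtain t where t: "t \<in> trees_on X" "tree_cost \<mu> h t = V\<^sub>0 h" using att0 by blast
  obtain p where p: "p \<in> pairs_on X" "pair_cost \<mu> h p = V\<^sub>1 h" using att1 by blast
  show ?thesis using that[of h t "V\<^sub>0 h" p] h t p le0 le1[of _ h] by simp
qed

theorem theorem1:
  fixes \<mu> :: "'s \<Rightarrow> real"
  assumes "finite (UNIV :: 's set)"
    and "card (UNIV :: 's set) \<ge> 2"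
    and "\<And>s. 0 < \<mu> s \<and> \<mu> s \<le> 1"
    and "(\<Sum>s \<in> UNIV. \<mu> s) = 1"
  shows "F_opt \<mu> \<inter> F_AIFV \<noteq> {}"
proof -
  have pos: "0 < \<mu> s" and nonneg: "0 \<le> \<mu> s" for s using assms(3)[of s] by auto
  obtain h v t p where hv: "0 \<le> h" "t \<in> trees_on UNIV" "tree_cost \<mu> h t = v"
    "p \<in> pairs_on UNIV" "pair_cost \<mu> h p = v + h"
    and min: "\<And>t. t \<in> trees_on UNIV \<Longrightarrow> v \<le> tree_cost \<mu> h t"
    "\<And>p. p \<in> pairs_on UNIV \<Longrightarrow> v + h \<le> pair_cost \<mu> h p"
    by (rule balanced_potential[of "UNIV :: 's set" \<mu>, OF assms(1,2) nonneg assms(4)]) (rule that)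
  let ?F = "aifv_code t p"
  have aifv: "?F \<in> F_AIFV" using aifv_code_in_AIFV hv by blast
  have reg: "?F \<in> F_reg \<mu>" using AIFV_regular[of ?F \<mu>] aifv assms(1,4) pos by blast
  have "?F \<in> F_0 \<mu>"
    using reg AIFV_ext[OF aifv assms(2)] AIFV_decodable[OF aifv] AIFV_wf[OF aifv]
    by (simp add: F_0_def F_2dec_def)
  moreover have "Lavg \<mu> ?F = v" using Lavg_aifv_code[OF assms(1) reg] hv by blast
  moreover have "v \<le> Lavg \<mu> F" if "F \<in> F_0 \<mu>" for F
    using Lavg_lower_bound[of \<mu> h F v] assms(1,2,4) nonneg hv(1) that min by blast
  ultimately have "?F \<in> F_opt \<mu>" by (simp add: F_opt_def)
  then show ?thesis using aifv by blast
qed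

end
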